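(* Let $k\ge 0$ and suppose that - $f$ is a $C^2$ vector function, - $g_1,\dots,g_m$ are non-constant $C^2$ functions, and - for all $i=1,\dots,m$, $w_i$ is a real-valued function defined on $[t_k,t_{k+1}]$ with $|w_i(t)|\le rV_i$ for some constant $r\in\mathbb{R}$, satisfying $$\int_{t_k}^{t_{k+1}}\bigl(v_i(t)-w_i(t)\bigr)\,dt=0,\qquad \int_{t_k}^{t_{k+1}}(t-t_{k+1/2})\bigl(v_i(t)-w_i(t)\bigr)\,dt=0.$$ Let $x$ and $y$ be solutions on $[t_k,t_{k+1}]$ of the input-affine system with inputs $v_i$ and of the auxiliary system with inputs $w_i$ respectively, with $x(t_k)=y(t_k)$. Then a local error $\|x(t_{k+1})-y(t_{k+1})\|$ of $O(h^2)$ is obtained, and the formula for the error is given by $$\begin{aligned} &\bigl(1-L(h_k/2)-h_k\,r\,L'\bigr)\,\|x(t_{k+1})-y(t_{k+1})\|\le \frac{h_k^2}{4}(1+r^2)\,L'K'\\ &\quad+\frac{h_k^3}{4}(1+r)\,K'\Bigl((2rH'+H)(K+rK')+L^2+(3rL+2r^2L')L'\Bigr)\varphi(\Lambda h_k)\\ &\quad+\frac{h_k^3}{24}(1+r)(K+K')\Bigl(3(HK'+LL')+4(H'K+LL')\Bigr). \end{aligned}$$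
   Context: Setting. The input-affine system is $$\dot x(t)=f(x(t))+\sum_{i=1}^m g_i(x(t))\,v_i(t),$$ where $f,g_1,\dots,g_m:\mathbb{R}^n\to\mathbb{R}^n$ and each $v_i$ is a measurable function with $v_i(t)\in[-V_i,V_i]$, $V_i>0$. Solutions are absolutely continuous functions satisfying the equation for almost every $t$. The interval $[0,T]$ is partitioned as $0=t_0<t_1<\dots<t_N=T$, $h_k=t_{k+1}-t_k$ and $t_{k+1/2}=t_k+h_k/2$. On $[t_k,t_{k+1}]$ the auxiliary system is $$\dot y(t)=f(y(t))+\sum_{i=1}^m g_i(y(t))\,w_i(t),\qquad y(t_k)=x(t_k).$$ Norms. $\|\cdot\|$ is the supremum norm on $\mathbb{R}^n$ and the corresponding induced norms on matrices and on second derivatives $D^2$ (bilinear maps). The logarithmic norm of a square matrix $Q$ is $\lambda(Q)=\lim_{h\to0^+}(\|I+hQ\|-1)/h$, i.e. $\lambda(Q)=\max_k\{q_{kk}+\sum_{i\ne k}|q_{ki}|\}$. Bounds. $B\subset\mathbb{R}^n$ is a bounding box for the solutions of both systems for all $t\in[0,T]$ (for all admissible inputs). The constants satisfy, for all $z\in B$ and all $i$: $\|f(z)\|\le K$, $\|g_i(z)\|\le K_i$, $\lambda(Df(z))\le\Lambda$, $\|Df(z)\|\le L$, $\|Dg_i(z)\|\le L_i$, $\|D^2f(z)\|\le H$, $\|D^2g_i(z)\|\le H_i$. Put $K'=\sum_{i=1}^m V_iK_i$, $L'=\sum_{i=1}^m V_iL_i$, $H'=\sum_{i=1}^m V_iH_i$,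 and $\varphi(s)=(e^s-1)/s$, with $\varphi(0)=1$. "Local error of $O(h^2)$" means bounded by $C h_k^2$ for all sufficiently small $h_k$, with $C$ depending only on the constants above, not on $k$ or on the particular inputs. *)

theory Defs
  imports "HOL-Analysis.Analysis"
begin

text \<open>The norm on \<open>\<real>\<^sup>n\<close> is the supremum norm \<^const>\<open>infnorm\<close>
  (not the Euclidean \<^const>\<open>norm\<close>); the norms of matrices and bilinear maps are induced by it.\<close>

definition mat_infnorm :: "real^'n^'m \<Rightarrow> real" where
  "mat_infnorm Q = (SUP u\<in>{u. infnorm u \<le> 1}. infnorm (Q *v u))"

definition bilin_infnorm :: "(real^'n \<Rightarrow> real^'n \<Rightarrow> real^'m) \<Rightarrow> real" where
  "bilin_infnorm b = (SUP (u, v)\<in>{u. infnorm u \<le> 1} \<times> {v. infnorm v \<le> 1}. infnorm (b u v))"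

text \<open>The limit always exists: by convexity of the norm the quotient is nondecreasing in \<open>h > 0\<close>,
  and it is bounded below by \<open>- mat_infnorm Q\<close>.\<close>

definition log_infnorm :: "real^'n^'n \<Rightarrow> real" where
  "log_infnorm Q = Lim (at_right 0) (\<lambda>h. (mat_infnorm (mat 1 + h *\<^sub>R Q) - 1) / h)"

definition D1 :: "(real^'n \<Rightarrow> real^'m) \<Rightarrow> real^'n \<Rightarrow> real^'n^'m" where
  "D1 f z = jacobian f (at z)"

definition D2 :: "(real^'n \<Rightarrow> real^'m) \<Rightarrow> real^'n \<Rightarrow> real^'n \<Rightarrow> real^'n \<Rightarrow> real^'m" where
  "D2 f z u v = frechet_derivative (D1 f) (at z) u *v v"

definition C2_fun :: "(real^'n \<Rightarrow> real^'m) \<Rightarrow> bool" where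
  "C2_fun f \<longleftrightarrow> f differentiable_on UNIV \<and> D1 f differentiable_on UNIV \<and>
     (\<forall>u v. continuous_on UNIV (\<lambda>z. D2 f z u v))"

text \<open>Finite families of non-overlapping closed subintervals of \<open>{a..b}\<close> are rendered as
  divisions (of their own union).\<close>

definition abs_continuous_on :: "real \<Rightarrow> real \<Rightarrow> (real \<Rightarrow> 'a::real_normed_vector) \<Rightarrow> bool" where
  "abs_continuous_on a b x \<longleftrightarrow>
     (\<forall>e>0. \<exists>d>0. \<forall>\<D> S. \<D> division_of S \<and> S \<subseteq> {a..b} \<and> (\<Sum>I\<in>\<D>. Sup I - Inf I) < d \<longrightarrow>
        (\<Sum>I\<in>\<D>. norm (x (Sup I) - x (Inf I))) < e)"

text \<open>Inputs are indexed by the finite type \<open>'m\<close> and are measurable with \<open>\<bar>v\<^sub>i(t)\<bar> \<le> V\<^sub>i\<close>.\<close>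

definition admissible_input :: "('m \<Rightarrow> real) \<Rightarrow> real \<Rightarrow> real \<Rightarrow> ('m \<Rightarrow> real \<Rightarrow> real) \<Rightarrow> bool" where
  "admissible_input V a b v \<longleftrightarrow>
     (\<forall>i. v i \<in> borel_measurable (lebesgue_on {a..b}) \<and> (\<forall>s\<in>{a..b}. v i s \<in> {- V i..V i}))"

definition input_affine_solution ::
  "(real^'n \<Rightarrow> real^'n) \<Rightarrow> ('m::finite \<Rightarrow> real^'n \<Rightarrow> real^'n) \<Rightarrow> ('m \<Rightarrow> real \<Rightarrow> real) \<Rightarrow>
     real \<Rightarrow> real \<Rightarrow> (real \<Rightarrow> real^'n) \<Rightarrow> bool" where
  "input_affine_solution f g v a b x \<longleftrightarrow> abs_continuous_on a b x \<and>
     (AE s in lebesgue_on {a..b}.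
        (x has_vector_derivative (f (x s) + (\<Sum>i\<in>UNIV. v i s *\<^sub>R g i (x s)))) (at s within {a..b}))"

definition field_bounds ::
  "(real^'n) set \<Rightarrow> (real^'n \<Rightarrow> real^'n) \<Rightarrow> ('m::finite \<Rightarrow> real^'n \<Rightarrow> real^'n) \<Rightarrow>
     real \<Rightarrow> ('m \<Rightarrow> real) \<Rightarrow> real \<Rightarrow> real \<Rightarrow> ('m \<Rightarrow> real) \<Rightarrow> real \<Rightarrow> ('m \<Rightarrow> real) \<Rightarrow> bool" where
  "field_bounds B f g K Kg \<Lambda> L Lg H Hg \<longleftrightarrow>
     (\<forall>z\<in>B. infnorm (f z) \<le> K \<and> log_infnorm (D1 f z) \<le> \<Lambda> \<and>
        mat_infnorm (D1 f z) \<le> L \<and> bilin_infnorm (D2 f z) \<le> H \<and>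
        (\<forall>i. infnorm (g i z) \<le> Kg i \<and> mat_infnorm (D1 (g i) z) \<le> Lg i \<and>
             bilin_infnorm (D2 (g i) z) \<le> Hg i))"

definition phi :: "real \<Rightarrow> real" where
  "phi s = (if s = 0 then 1 else (exp s - 1) / s)"

definition time_partition :: "real \<Rightarrow> nat \<Rightarrow> (nat \<Rightarrow> real) \<Rightarrow> bool" where
  "time_partition T N t \<longleftrightarrow> t 0 = 0 \<and> t N = T \<and> (\<forall>j<N. t j < t (Suc j))"

end

theory Submission
  imports Defs
begin

text \<open>
  Write \<open>a\<close>, \<open>b\<close> for the two time points, \<open>h = b - a\<close>, \<open>m\<close> for the midpoint.  Only one component
  \<open>p\<close> of \<open>x b - y b\<close> is followed, the one that realises the supremum norm, so that all integrals are
  integrals of real functions.  It equals the integral over \<open>{a..b}\<close> of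
  \<open>f\<^sub>p x - f\<^sub>p y + (\<Sum>i. v\<^sub>i g\<^sub>i\<^sub>p x - w\<^sub>i g\<^sub>i\<^sub>p y)\<close>, and the proof is one integration by parts of this
  expression: \<open>f\<^sub>p x - f\<^sub>p y\<close> is integrated against \<open>t - m\<close>, and \<open>v\<^sub>i\<close>, \<open>w\<^sub>i\<close> are replaced by primitives.

  The primitives \<open>P\<^sub>i\<close> of \<open>v\<^sub>i\<close> and \<open>Q\<^sub>i\<close> of \<open>w\<^sub>i\<close> are centred: they take opposite values at \<open>a\<close> and
  \<open>b\<close>.  The first moment condition makes these end values the same for both, so that the boundary terms
  collapse to multiples of the error itself; they account for the terms subtracted from \<open>1\<close> on the left.
  Centring also gains a factor two: a function with Lipschitz constant \<open>M\<close> and opposite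
  end values satisfies \<open>\<bar>U t\<bar> + \<bar>U (t + h/2)\<bar> \<le> M h/2\<close>, hence \<open>\<integral>\<bar>U\<bar> \<le> M h\<^sup>2/4\<close>.

  What remains under the integral is \<open>(t - m)\<close> times the difference of the derivatives of \<open>f\<^sub>p\<close> along
  the two trajectories, and \<open>P\<^sub>i\<close>, \<open>Q\<^sub>i\<close> times the derivatives of \<open>g\<^sub>i\<^sub>p\<close> along \<open>x\<close> and \<open>y\<close>.  The
  products \<open>P\<^sub>i v\<^sub>j\<close> and \<open>Q\<^sub>i w\<^sub>j\<close> are bounded outright; they are the second order term with the factor
  \<open>1 + r\<^sup>2\<close>.  Every other contribution is of third order for one of two reasons.  Either a field is
  compared at \<open>x t\<close> and \<open>y t\<close>, and the logarithmic norm bounds the distance of the trajectories by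
  \<open>(1 + r) K' h \<phi>(\<Lambda> h)\<close> (\<open>log_infnorm_growth\<close>, \<open>trajectories_close\<close>).  Or a field at \<open>x t\<close>
  multiplies \<open>(t - m) (v\<^sub>i - w\<^sub>i)\<close> or \<open>P\<^sub>i - Q\<^sub>i\<close>; by the moment conditions both of these integrate to
  zero, so the field may be compared with its value at \<open>x m\<close>.  Adding up (\<open>component_error_le\<close>) gives
  an estimate that is termwise at most the claimed one (\<open>local_error_le\<close>), and the order \<open>h\<^sup>2\<close>
  follows as soon as the factor on the left is at least \<open>1/2\<close>.

  Inputs are merely measurable and trajectories merely absolutely continuous, so the two calculus rules
  used, the fundamental theorem of calculus and integration by parts, are proved directly
  from the gauge definition of the integral.
\<close>

section \<open>Absolutely continuous functions and indefinite integrals\<close>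

text \<open>The increments of \<open>F\<close> over a tagged division telescope, so a Riemann sum may be compared with
  \<open>F b - F a\<close> interval by interval.\<close>

lemma has_integral_if_increments_approximated:
  fixes F \<phi> :: "real \<Rightarrow> real"
  assumes "a \<le> b"
    and approx: "\<And>e. e > 0 \<Longrightarrow> \<exists>\<gamma>. gauge \<gamma> \<and> (\<forall>p. p tagged_division_of {a..b} \<and> \<gamma> fine p \<longrightarrow>
        (\<Sum>(t,I)\<in>p. \<bar>measure lborel I * \<phi> t - (F (Sup I) - F (Inf I))\<bar>) \<le> e)"
  shows "(\<phi> has_integral (F b - F a)) {a..b}"
  unfolding has_integral_real
proof (intro allI impI)
  fix e :: real assume "e > 0"
  then obtain \<gamma> where "gauge \<gamma>" and \<gamma>: "\<And>p. p tagged_division_of {a..b} \<Longrightarrow> \<gamma> fine p \<Longrightarrow>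
        (\<Sum>(t,I)\<in>p. \<bar>measure lborel I * \<phi> t - (F (Sup I) - F (Inf I))\<bar>) \<le> e/2"
    using approx[of "e/2"] by auto
  have "norm ((\<Sum>(t,I)\<in>p. measure lborel I *\<^sub>R \<phi> t) - (F b - F a)) < e"
    if p: "p tagged_division_of {a..b}" "\<gamma> fine p" for p
  proof -
    have "(\<Sum>(t,I)\<in>p. measure lborel I *\<^sub>R \<phi> t) - (F b - F a)
        = (\<Sum>(t,I)\<in>p. measure lborel I *\<^sub>R \<phi> t) - (\<Sum>(t,I)\<in>p. F (Sup I) - F (Inf I))"
      using additive_tagged_division_1[OF \<open>a \<le> b\<close> p(1), of F] by simp
    also have "\<dots> = (\<Sum>(t,I)\<in>p. measure lborel I * \<phi> t - (F (Sup I) - F (Inf I)))"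
      by (simp add: sum_subtractf split_beta)
    also have "norm \<dots> \<le> (\<Sum>(t,I)\<in>p. \<bar>measure lborel I * \<phi> t - (F (Sup I) - F (Inf I))\<bar>)"
      unfolding real_norm_def by (rule order_trans[OF sum_abs]) (simp add: split_beta)
    finally show ?thesis using \<gamma>[OF p] \<open>e > 0\<close> by simp
  qed
  then show "\<exists>\<gamma>. gauge \<gamma> \<and> (\<forall>p. p tagged_division_of {a..b} \<and> \<gamma> fine p \<longrightarrow>
      norm ((\<Sum>(t,I)\<in>p. measure lborel I *\<^sub>R \<phi> t) - (F b - F a)) < e)"
    using \<open>gauge \<gamma>\<close> by blast
qed

lemma tagged_division_real_interval:
  fixes I :: "real set"
  assumes "p tagged_division_of {a..b}" "(t, I) \<in> p"
  obtains u v where "I = {u..v}" "u \<le> t" "t \<le> v" "a \<le> u" "v \<le> b"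
    "Inf I = u" "Sup I = v" "measure lborel I = v - u"
proof -
  have "t \<in> I" "I \<subseteq> {a..b}" using tagged_division_ofD(2,3)[OF assms] by auto
  moreover obtain u v where "I = {u..v}" using tagged_division_ofD(4)[OF assms] by (metis box_real(2))
  ultimately show thesis using that[of u v] by auto
qed

lemma sum_content_tags_le_measure:
  fixes p :: "(real \<times> real set) set"
  assumes p: "p tagged_division_of {a..b}" and q: "q \<subseteq> p"
    and U: "U \<in> lmeasurable" and sub: "\<And>t I. (t,I) \<in> q \<Longrightarrow> I \<subseteq> U"
  shows "(\<Sum>I\<in>snd ` q. measure lborel I) \<le> measure lebesgue U"
proof -
  have qd: "q tagged_partial_division_of {a..b}"
    using tagged_partial_division_subset[OF _ q] p by (simp add: tagged_division_of_def)
  then have D: "snd ` q division_of \<Union>(snd ` q)" by (rule partial_division_of_tagged_division)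
  have neg: "pairwise (\<lambda>S T. negligible (S \<inter> T)) (snd ` q)"
  proof (rule pairwiseI)
    fix S T assume ST: "S \<in> snd ` q" "T \<in> snd ` q" "S \<noteq> T"
    have "convex (S \<inter> T)"
      using division_ofD(4)[OF D ST(1)] division_ofD(4)[OF D ST(2)] convex_box(1) by (intro convex_Int) blast+
    moreover have "interior (S \<inter> T) = {}" using division_ofD(5)[OF D ST] by simp
    ultimately show "negligible (S \<inter> T)" using negligible_convex_interior by blast
  qed
  have meas: "\<And>I. I \<in> snd ` q \<Longrightarrow> I \<in> lmeasurable"
    using division_ofD(4)[OF D] by fastforce
  have "(\<Sum>I\<in>snd ` q. measure lborel I) = (\<Sum>I\<in>snd ` q. measure lebesgue I)"
    using division_ofD(4)[OF D] by (intro sum.cong) (fastforce simp: measure_completion)+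
  also have "\<dots> = measure lebesgue (\<Union>(snd ` q))"
    using measure_negligible_finite_Union[OF division_ofD(1)[OF D] meas neg] by simp
  also have "\<dots> \<le> measure lebesgue U"
  proof (rule measure_mono_fmeasurable[OF _ _ U])
    show "\<Union>(snd ` q) \<subseteq> U" using sub by fastforce
    show "\<Union>(snd ` q) \<in> sets lebesgue"
      using meas division_ofD(1)[OF D] by (intro sets.finite_Union) auto
  qed
  finally show ?thesis .
qed

text \<open>Absolute continuity speaks of sets of intervals, Riemann sums of tagged intervals.  Two tags can share
  an interval only if it is degenerate, and then its increment vanishes.\<close>

lemma sum_tags_eq_sum_intervals:
  fixes p :: "(real \<times> real set) set"
  assumes p: "p tagged_division_of {a..b}" and q: "q \<subseteq> p"
  shows "(\<Sum>(t,I)\<in>q. \<bar>F (Sup I) - F (Inf I)\<bar>) = (\<Sum>I\<in>snd ` q. \<bar>F (Sup I) - F (Inf I) :: real\<bar>)"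
proof -
  have "(\<Sum>I\<in>snd ` q. \<bar>F (Sup I) - F (Inf I)\<bar>) = (\<Sum>z\<in>q. ((\<lambda>I. \<bar>F (Sup I) - F (Inf I)\<bar>) \<circ> snd) z)"
  proof (rule sum.reindex_nontrivial)
    show "finite q" using tagged_division_of_finite[OF p] q finite_subset by blast
    fix z z' assume zz: "z \<in> q" "z' \<in> q" "z \<noteq> z'" "snd z = snd z'"
    obtain t I t' where z: "z = (t, I)" "z' = (t', I)" using zz(4) by (metis prod.collapse)
    have "interior I \<inter> interior I = {}"
      using tagged_division_ofD(5)[OF p, of t I t' I] zz q z by blast
    then show "\<bar>F (Sup (snd z)) - F (Inf (snd z))\<bar> = 0"
      using tagged_division_real_interval[OF p, of t I] zz(1) q z
      by (smt (verit) greaterThanLessThan_empty_iff inf.idem interior_atLeastAtMost_real snd_conv subsetD)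
  qed
  then show ?thesis by (simp add: split_beta)
qed

text \<open>The gauge separates the tags: at a point of differentiability
  the derivative controls the increment, while intervals tagged in the exceptional null set are forced into an
  open set of small measure, where absolute continuity makes the sum of the increments small.\<close>

lemma abs_continuous_has_integral_derivative:
  fixes F \<phi> :: "real \<Rightarrow> real"
  assumes "a \<le> b" and ac: "abs_continuous_on a b F" and N: "negligible N"
    and der: "\<And>t. t \<in> {a..b} \<Longrightarrow> t \<notin> N \<Longrightarrow> (F has_vector_derivative \<phi> t) (at t within {a..b})"
  shows "(\<phi> has_integral (F b - F a)) {a..b}"
proof -
  \<comment> \<open>The value of the integrand on the null set is immaterial; with \<open>0\<close> there, such tags contribute increments only.\<close>
  define \<phi>0 where "\<phi>0 t = (if t \<in> N then 0 else \<phi> t)" for t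
  have "(\<phi>0 has_integral (F b - F a)) {a..b}"
  proof (rule has_integral_if_increments_approximated[OF \<open>a \<le> b\<close>])
    fix e :: real assume "e > 0"
    obtain d where "d > 0" and d: "\<And>\<D> S. \<D> division_of S \<Longrightarrow> S \<subseteq> {a..b} \<Longrightarrow>
        (\<Sum>I\<in>\<D>. Sup I - Inf I) < d \<Longrightarrow> (\<Sum>I\<in>\<D>. \<bar>F (Sup I) - F (Inf I)\<bar>) < e/2"
      using ac \<open>e > 0\<close> unfolding abs_continuous_on_def real_norm_def by (metis half_gt_zero)
    have "N \<in> null_sets lebesgue" using N negligible_iff_null_sets by blast
    then have "N \<in> sets lebesgue" by auto
    then obtain U where U: "open U" "N \<subseteq> U" "U - N \<in> lmeasurable" "emeasure lebesgue (U - N) < ennreal d"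
      using sets_lebesgue_outer_open[OF _ \<open>d > 0\<close>] by metis
    have Um: "U \<in> lmeasurable"
      using U(2,3) N by (metis Diff_partition fmeasurable.Un negligible_imp_measurable)
    have "measure lebesgue U = measure lebesgue (U - N)"
      using N \<open>N \<in> null_sets lebesgue\<close> Um by (metis fmeasurableD measure_Diff_null_set)
    also have "\<dots> < d"
      using U(3,4) \<open>d > 0\<close> by (metis emeasure_eq_measure2 ennreal_less_iff measure_nonneg)
    finally have Ud: "measure lebesgue U < d" .
    define \<epsilon> where "\<epsilon> = e / (2 * (b - a + 1))"
    have \<epsilon>: "\<epsilon> > 0" "\<epsilon> * (b - a) \<le> e/2"
      using \<open>e > 0\<close> \<open>a \<le> b\<close> by (auto simp: \<epsilon>_def field_simps)
    have "\<exists>\<delta>>0. \<forall>s\<in>{a..b}. \<bar>s - t\<bar> < \<delta> \<longrightarrow> \<bar>F s - F t - (s - t) * \<phi> t\<bar> \<le> \<epsilon> * \<bar>s - t\<bar>"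
      if "t \<in> {a..b}" "t \<notin> N" for t
      using der[OF that] \<epsilon>(1) unfolding has_vector_derivative_def has_derivative_within_alt by fastforce
    then obtain \<delta> where \<delta>: "\<And>t. t \<in> {a..b} \<Longrightarrow> t \<notin> N \<Longrightarrow> \<delta> t > 0"
      "\<And>t s. t \<in> {a..b} \<Longrightarrow> t \<notin> N \<Longrightarrow> s \<in> {a..b} \<Longrightarrow> \<bar>s - t\<bar> < \<delta> t \<Longrightarrow>
         \<bar>F s - F t - (s - t) * \<phi> t\<bar> \<le> \<epsilon> * \<bar>s - t\<bar>"
      by metis
    define \<gamma> where "\<gamma> t = (if t \<in> N then U else if t \<in> {a..b} then ball t (\<delta> t) else ball t 1)" for t
    have "gauge \<gamma>" using U \<delta>(1) by (auto simp: gauge_def \<gamma>_def)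
    have est: "(\<Sum>(t,I)\<in>p. \<bar>measure lborel I * \<phi>0 t - (F (Sup I) - F (Inf I))\<bar>) \<le> e"
      if p: "p tagged_division_of {a..b}" and fine: "\<gamma> fine p" for p
    proof -
      let ?T = "\<lambda>(t,I). \<bar>measure lborel I * \<phi>0 t - (F (Sup I) - F (Inf I))\<bar>"
      define q where "q = {z \<in> p. fst z \<in> N}"
      have fin: "finite p" using p by blast
      have qp: "q \<subseteq> p" by (auto simp: q_def)
      have sub: "I \<subseteq> U" if "(t,I) \<in> q" for t I
        using fine that by (fastforce simp: fine_def q_def \<gamma>_def)
      have D: "snd ` q division_of \<Union>(snd ` q)"
        using tagged_partial_division_subset[OF _ qp] p 
        by (intro partial_division_of_tagged_division) (auto simp: tagged_division_of_def)
      have "(\<Sum>I\<in>snd ` q. Sup I - Inf I) = (\<Sum>I\<in>snd ` q. measure lborel I)"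
      proof (rule sum.cong)
        fix I assume "I \<in> snd ` q"
        then obtain t where "(t, I) \<in> p" using qp by auto
        then show "Sup I - Inf I = measure lborel I" using tagged_division_real_interval[OF p] by metis
      qed simp
      also have "\<dots> < d"
        using sum_content_tags_le_measure[OF p qp Um] sub Ud by (meson le_less_trans)
      finally have "(\<Sum>I\<in>snd ` q. \<bar>F (Sup I) - F (Inf I)\<bar>) < e/2"
        using d[OF D] qp tagged_division_ofD(3)[OF p] by fastforce
      then have 1: "sum ?T q < e/2"
        using sum_tags_eq_sum_intervals[OF p qp, of F] by (simp add: q_def \<phi>0_def split_beta abs_minus_commute)
      have "?T z \<le> \<epsilon> * measure lborel (snd z)" if "z \<in> p - q" for z
      proof -
        obtain t I where z: "z = (t, I)" "(t, I) \<in> p" "t \<notin> N"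
          using \<open>z \<in> p - q\<close> by (cases z) (auto simp: q_def)
        obtain u v where I: "I = {u..v}" "u \<le> t" "t \<le> v" "a \<le> u" "v \<le> b"
          "Inf I = u" "Sup I = v" "measure lborel I = v - u" using tagged_division_real_interval[OF p z(2)] .
        have t: "t \<in> {a..b}" using I by auto
        have "I \<subseteq> ball t (\<delta> t)" using fine z t by (fastforce simp: fine_def \<gamma>_def)
        moreover have "u \<in> I" "v \<in> I" using I(1-3) by auto
        ultimately have "u \<in> ball t (\<delta> t)" "v \<in> ball t (\<delta> t)" by blast+
        then have "\<bar>u - t\<bar> < \<delta> t" "\<bar>v - t\<bar> < \<delta> t" by (auto simp: dist_real_def)
        then have "\<bar>F u - F t - (u - t) * \<phi> t\<bar> \<le> \<epsilon> * (t - u)" "\<bar>F v - F t - (v - t) * \<phi> t\<bar> \<le> \<epsilon> * (v - t)"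
          using \<delta>(2)[OF t z(3), of u] \<delta>(2)[OF t z(3), of v] I by auto
        then show ?thesis using z I by (simp add: \<phi>0_def algebra_simps)
      qed
      then have "sum ?T (p - q) \<le> (\<Sum>z\<in>p - q. \<epsilon> * measure lborel (snd z))" by (rule sum_mono)
      also have "\<dots> \<le> (\<Sum>z\<in>p. \<epsilon> * measure lborel (snd z))"
        using fin \<epsilon>(1) by (intro sum_mono2) auto
      also have "\<dots> = \<epsilon> * (b - a)"
        using additive_content_tagged_division[of p a b] p \<open>a \<le> b\<close>
        by (simp add: sum_distrib_left[symmetric] split_beta)
      finally have "sum ?T (p - q) \<le> e/2" using \<epsilon>(2) by linarith
      moreover have "sum ?T p = sum ?T (p - q) + sum ?T q" by (rule sum.subset_diff[OF qp fin])
      ultimately show ?thesis using 1 by linarith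
    qed
    show "\<exists>\<gamma>. gauge \<gamma> \<and> (\<forall>p. p tagged_division_of {a..b} \<and> \<gamma> fine p \<longrightarrow>
        (\<Sum>(t,I)\<in>p. \<bar>measure lborel I * \<phi>0 t - (F (Sup I) - F (Inf I))\<bar>) \<le> e)"
    proof (intro exI[of _ \<gamma>] conjI allI impI, goal_cases)
      case 1 show ?case by (rule \<open>gauge \<gamma>\<close>)
    next
      case (2 p) then show ?case by (intro est) simp_all
    qed
  qed
  from has_integral_spike[OF N _ this, of \<phi>] show ?thesis by (simp add: \<phi>0_def)
qed

lemma indefinite_integral_lipschitz:
  fixes U u :: "real \<Rightarrow> real"
  assumes int: "\<And>s t. a \<le> s \<Longrightarrow> s \<le> t \<Longrightarrow> t \<le> b \<Longrightarrow> (u has_integral (U t - U s)) {s..t}"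
    and bnd: "\<And>t. t \<in> {a..b} \<Longrightarrow> \<bar>u t\<bar> \<le> M"
    and st: "s \<in> {a..b}" "t \<in> {a..b}"
  shows "\<bar>U t - U s\<bar> \<le> M * \<bar>t - s\<bar>"
proof -
  have "\<bar>U t - U s\<bar> \<le> M * (t - s)" if "s \<le> t" "s \<in> {a..b}" "t \<in> {a..b}" for s t
  proof -
    have "norm (U t - U s) \<le> M * measure lborel {s..t}"
    proof (rule has_integral_bound_real[where S = "{}"])
      show "0 \<le> M" using bnd[of s] that by (meson abs_ge_zero order_trans)
      show "(u has_integral (U t - U s)) {s..t}" using int that by auto
      show "norm (u x) \<le> M" if "x \<in> {s..t} - {}" for x
        using bnd[of x] that \<open>s \<in> {a..b}\<close> \<open>t \<in> {a..b}\<close> by auto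
    qed simp
    then show ?thesis using that by simp
  qed
  from this[of s t] this[of t s] st show ?thesis by (cases "s \<le> t") (auto simp: abs_minus_commute)
qed

text \<open>Neither factor needs to be differentiable anywhere.  By Henstock's lemma the increments
  of \<open>U\<close> and \<open>W\<close> are, summed over a fine division, close to \<open>u\<close> and \<open>w\<close> times the lengths.  The product
  increment differs from the sum of the two mixed terms only by products of two increments, which the
  Lipschitz bounds and a gauge of radius \<open>d\<close> make small.\<close>

lemma integration_by_parts_indefinite:
  fixes U u W w :: "real \<Rightarrow> real"
  assumes "a \<le> b"
    and U: "\<And>s t. a \<le> s \<Longrightarrow> s \<le> t \<Longrightarrow> t \<le> b \<Longrightarrow> (u has_integral (U t - U s)) {s..t}"
    and W: "\<And>s t. a \<le> s \<Longrightarrow> s \<le> t \<Longrightarrow> t \<le> b \<Longrightarrow> (w has_integral (W t - W s)) {s..t}"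
    and bu: "\<And>t. t \<in> {a..b} \<Longrightarrow> \<bar>u t\<bar> \<le> Mu" and bw: "\<And>t. t \<in> {a..b} \<Longrightarrow> \<bar>w t\<bar> \<le> Mw"
  shows "((\<lambda>t. u t * W t + U t * w t) has_integral (U b * W b - U a * W a)) {a..b}"
proof (rule has_integral_if_increments_approximated[OF \<open>a \<le> b\<close>, where F = "\<lambda>t. U t * W t"])
  fix e :: real assume "e > 0"
  note lipU = indefinite_integral_lipschitz[where a = a and b = b, OF U bu]
  note lipW = indefinite_integral_lipschitz[where a = a and b = b, OF W bw]
  have M0: "Mu \<ge> 0" "Mw \<ge> 0" using bu[of a] bw[of a] \<open>a \<le> b\<close> by auto
  define CU where "CU = \<bar>U a\<bar> + Mu * (b - a) + 1"
  define CW where "CW = \<bar>W a\<bar> + Mw * (b - a) + 1"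
  have CU: "\<bar>U t\<bar> \<le> CU" and CW: "\<bar>W t\<bar> \<le> CW" if "t \<in> {a..b}" for t
  proof -
    have "Mu * \<bar>t - a\<bar> \<le> Mu * (b - a)" "Mw * \<bar>t - a\<bar> \<le> Mw * (b - a)"
      using that M0 by (auto intro!: mult_left_mono)
    then show "\<bar>U t\<bar> \<le> CU" "\<bar>W t\<bar> \<le> CW"
      using lipU[of a t] lipW[of a t] that by (auto simp: CU_def CW_def)
  qed
  have C1: "CU > 0" "CW > 0" using M0 \<open>a \<le> b\<close> by (auto simp: CU_def CW_def intro!: add_nonneg_pos)
  have int: "u integrable_on cbox a b" "w integrable_on cbox a b"
    using U[of a b] W[of a b] \<open>a \<le> b\<close> by (auto simp: integrable_on_def)
  have e4: "e / (4 * CW) > 0" "e / (4 * CU) > 0" using C1 \<open>e > 0\<close> by auto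
  obtain \<gamma>1 where g1: "gauge \<gamma>1" "\<And>p. p tagged_partial_division_of (cbox a b) \<Longrightarrow> \<gamma>1 fine p \<Longrightarrow>
     (\<Sum>(x,k)\<in>p. norm (measure lborel k *\<^sub>R u x - integral k u)) < e / (4 * CW)"
  proof (rule Henstock_lemma[OF int(1) e4(1)], goal_cases)
    case (1 \<gamma>)
    show ?case by (rule that[OF 1(2) 1(3)])
  qed
  obtain \<gamma>2 where g2: "gauge \<gamma>2" "\<And>p. p tagged_partial_division_of (cbox a b) \<Longrightarrow> \<gamma>2 fine p \<Longrightarrow>
     (\<Sum>(x,k)\<in>p. norm (measure lborel k *\<^sub>R w x - integral k w)) < e / (4 * CU)"
  proof (rule Henstock_lemma[OF int(2) e4(2)], goal_cases)
    case (1 \<gamma>)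
    show ?case by (rule that[OF 1(2) 1(3)])
  qed
  define d where "d = e / (4 * (Mu * Mw + 1) * (b - a + 1))"
  have d: "d > 0" "2 * Mu * Mw * d * (b - a) \<le> e / 2"
  proof -
    have P: "Mu * Mw \<ge> 0" using M0 by simp
    then show "d > 0" using \<open>e > 0\<close> \<open>a \<le> b\<close> by (auto simp: d_def intro!: divide_pos_pos mult_pos_pos add_nonneg_pos)
    have "(Mu * Mw) * (b - a) \<le> (Mu * Mw + 1) * (b - a + 1)"
      using P \<open>a \<le> b\<close> by (intro mult_mono) auto
    then have "(Mu * Mw) * (b - a) * d \<le> (Mu * Mw + 1) * (b - a + 1) * d"
      using \<open>d > 0\<close> by (intro mult_right_mono) auto
    also have "\<dots> = e / 4"
    proof -
      have "Mu * Mw + 1 \<noteq> 0" "b - a + 1 \<noteq> 0" using P \<open>a \<le> b\<close> by linarith+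
      moreover have "A * B * (e / (4 * A * B)) = e / 4" if "A \<noteq> 0" "B \<noteq> 0" for A B :: real
        using that by simp
      ultimately show ?thesis unfolding d_def by blast
    qed
    finally show "2 * Mu * Mw * d * (b - a) \<le> e / 2" by (simp add: algebra_simps)
  qed
  define \<gamma> where "\<gamma> t = \<gamma>1 t \<inter> \<gamma>2 t \<inter> ball t d" for t
  have "gauge \<gamma>" using g1(1) g2(1) d(1) by (auto simp: gauge_def \<gamma>_def)
  have est: "(\<Sum>(t,I)\<in>p. \<bar>measure lborel I * (u t * W t + U t * w t) - (U (Sup I) * W (Sup I) - U (Inf I) * W (Inf I))\<bar>) \<le> e"
    if p: "p tagged_division_of {a..b}" and fine: "\<gamma> fine p" for p
  proof -
    have pp: "p tagged_partial_division_of (cbox a b)" using p by (simp add: tagged_division_of_def)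
    have f12: "\<gamma>1 fine p" "\<gamma>2 fine p" using fine by (auto simp: fine_def \<gamma>_def)
    have summand: "\<bar>measure lborel I * (u t * W t + U t * w t) - (U (Sup I) * W (Sup I) - U (Inf I) * W (Inf I))\<bar>
       \<le> CW * \<bar>measure lborel I * u t - integral I u\<bar> + CU * \<bar>measure lborel I * w t - integral I w\<bar> + 2 * Mu * Mw * d * measure lborel I"
      if tI: "(t, I) \<in> p" for t I
    proof -
      obtain c c' where I: "I = {c..c'}" "c \<le> t" "t \<le> c'" "a \<le> c" "c' \<le> b"
          "Inf I = c" "Sup I = c'" "measure lborel I = c' - c" using tagged_division_real_interval[OF p tI] .
      have "I \<subseteq> ball t d" using fine tI by (auto simp: fine_def \<gamma>_def)
      then have near: "c' - t \<le> d" "t - c \<le> d" using I by (force simp: dist_real_def subset_iff)+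
      have mem: "t \<in> {a..b}" "c \<in> {a..b}" "c' \<in> {a..b}" using I by auto
      have iu: "integral I u = U c' - U c" and iw: "integral I w = W c' - W c"
        using U[of c c'] W[of c c'] I by (auto intro!: integral_unique)
      have e1: "\<bar>((c' - c) * u t - (U c' - U c)) * W t\<bar> \<le> CW * \<bar>(c' - c) * u t - (U c' - U c)\<bar>"
        using mult_right_mono[OF CW[OF mem(1)], of "\<bar>(c' - c) * u t - (U c' - U c)\<bar>"]
        by (simp add: abs_mult mult.commute)
      have e2: "\<bar>U t * ((c' - c) * w t - (W c' - W c))\<bar> \<le> CU * \<bar>(c' - c) * w t - (W c' - W c)\<bar>"
        using CU[OF mem(1)] by (simp add: abs_mult mult_right_mono)
      have e3: "\<bar>(U c' - U c) * (W c' - W t)\<bar> \<le> (Mu * (c' - c)) * (Mw * d)"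
      proof -
        have "\<bar>W c' - W t\<bar> \<le> Mw * d"
          using lipW[of t c'] mem near I M0 by (smt (verit) mult_left_mono)
        then show ?thesis unfolding abs_mult
          using lipU[of c c'] mem I M0 by (intro mult_mono) (auto simp: abs_mult)
      qed
      have e4: "\<bar>(W c' - W c) * (U t - U c)\<bar> \<le> (Mw * (c' - c)) * (Mu * d)"
      proof -
        have "\<bar>U t - U c\<bar> \<le> Mu * d"
          using lipU[of c t] mem near I M0 by (smt (verit) mult_left_mono)
        then show ?thesis unfolding abs_mult
          using lipW[of c c'] mem I M0 by (intro mult_mono) (auto simp: abs_mult)
      qed
      have tri: "\<bar>p + q - r + s\<bar> \<le> P + Q + R + S"
        if "\<bar>p\<bar> \<le> P" "\<bar>q\<bar> \<le> Q" "\<bar>r\<bar> \<le> R" "\<bar>s\<bar> \<le> S" for p q r s P Q R S :: real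
        using that by linarith
      have "measure lborel I * (u t * W t + U t * w t) - (U (Sup I) * W (Sup I) - U (Inf I) * W (Inf I))
         = ((c' - c) * u t - (U c' - U c)) * W t + U t * ((c' - c) * w t - (W c' - W c))
           - (U c' - U c) * (W c' - W t) + (W c' - W c) * (U t - U c)"
        unfolding I(6-8) by algebra
      also have "\<bar>\<dots>\<bar> \<le> CW * \<bar>(c' - c) * u t - (U c' - U c)\<bar> + CU * \<bar>(c' - c) * w t - (W c' - W c)\<bar>
          + (Mu * (c' - c)) * (Mw * d) + (Mw * (c' - c)) * (Mu * d)"
        by (rule tri[OF e1 e2 e3 e4])
      also have "(Mu * (c' - c)) * (Mw * d) = Mu * Mw * d * measure lborel I" unfolding I(8) by (simp only: mult_ac)
      also have "(Mw * (c' - c)) * (Mu * d) = Mu * Mw * d * measure lborel I" unfolding I(8) by (simp only: mult_ac)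
      finally show ?thesis unfolding iu iw I(8) by linarith
    qed
    have "(\<Sum>(t,I)\<in>p. \<bar>measure lborel I * (u t * W t + U t * w t) - (U (Sup I) * W (Sup I) - U (Inf I) * W (Inf I))\<bar>)
       \<le> (\<Sum>(t,I)\<in>p. CW * \<bar>measure lborel I * u t - integral I u\<bar> + CU * \<bar>measure lborel I * w t - integral I w\<bar> + 2 * Mu * Mw * d * measure lborel I)"
      by (rule sum_mono) (use summand in \<open>simp add: split_beta\<close>)
    also have "\<dots> = CW * (\<Sum>(t,I)\<in>p. \<bar>measure lborel I * u t - integral I u\<bar>)
        + CU * (\<Sum>(t,I)\<in>p. \<bar>measure lborel I * w t - integral I w\<bar>) + 2 * Mu * Mw * d * (\<Sum>(t,I)\<in>p. measure lborel I)"
      by (simp add: sum.distrib sum_distrib_left split_beta)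
    also have "(\<Sum>(t,I)\<in>p. measure lborel I) = b - a"
      using additive_content_tagged_division[of p a b] p \<open>a \<le> b\<close> by (simp add: split_beta)
    also have "CW * (\<Sum>(t,I)\<in>p. \<bar>measure lborel I * u t - integral I u\<bar>) \<le> CW * (e / (4 * CW))"
      using g1(2)[OF pp f12(1)] C1 by (intro mult_left_mono) auto
    also have "CU * (\<Sum>(t,I)\<in>p. \<bar>measure lborel I * w t - integral I w\<bar>) \<le> CU * (e / (4 * CU))"
      using g2(2)[OF pp f12(2)] C1 by (intro mult_left_mono) auto
    finally show ?thesis using d(2) C1 by simp
  qed
  show "\<exists>\<gamma>. gauge \<gamma> \<and> (\<forall>p. p tagged_division_of {a..b} \<and> \<gamma> fine p \<longrightarrow>
      (\<Sum>(t,I)\<in>p. \<bar>measure lborel I * (u t * W t + U t * w t) - (U (Sup I) * W (Sup I) - U (Inf I) * W (Inf I))\<bar>) \<le> e)"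
  proof (intro exI[of _ \<gamma>] conjI allI impI, goal_cases)
    case 1 show ?case by (rule \<open>gauge \<gamma>\<close>)
  next
    case (2 p) then show ?case by (intro est) simp_all
  qed
qed

section \<open>Norms induced by the supremum norm\<close>

lemma infnorm_le_iff_cart: "infnorm (x :: real^'n) \<le> c \<longleftrightarrow> (\<forall>i. \<bar>x $ i\<bar> \<le> c)"
proof -
  have "{\<bar>x $ i\<bar> |i. i \<in> UNIV} = range (\<lambda>i. \<bar>x $ i\<bar>)" by auto
  then have "infnorm x = Max (range (\<lambda>i. \<bar>x $ i\<bar>))" by (simp add: infnorm_cart cSup_eq_Max)
  then show ?thesis by auto
qed

lemma infnorm_attained_cart: obtains i where "infnorm (x :: real^'n) = \<bar>x $ i\<bar>"
proof -
  have "{\<bar>x $ i\<bar> |i. i \<in> UNIV} = range (\<lambda>i. \<bar>x $ i\<bar>)" by auto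
  then have "infnorm x = Max (range (\<lambda>i. \<bar>x $ i\<bar>))" by (simp add: infnorm_cart cSup_eq_Max)
  moreover have "Max (range (\<lambda>i. \<bar>x $ i\<bar>)) \<in> range (\<lambda>i. \<bar>x $ i\<bar>)" by (rule Max_in) auto
  ultimately show thesis using that by (metis imageE)
qed

lemma infnorm_matrix_vector_le_rows:
  fixes Q :: "real^'n^'m"
  assumes "\<And>k. (\<Sum>i\<in>UNIV. \<bar>Q $ k $ i\<bar>) \<le> c"
  shows "infnorm (Q *v u) \<le> c * infnorm u"
  unfolding infnorm_le_iff_cart
proof
  fix k
  have "\<bar>(Q *v u) $ k\<bar> \<le> (\<Sum>i\<in>UNIV. \<bar>Q $ k $ i * u $ i\<bar>)"
    unfolding matrix_vector_mult_def by simp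
  also have "\<dots> \<le> (\<Sum>i\<in>UNIV. \<bar>Q $ k $ i\<bar> * infnorm u)"
    by (intro sum_mono) (simp add: abs_mult mult_left_mono component_le_infnorm_cart)
  also have "\<dots> = (\<Sum>i\<in>UNIV. \<bar>Q $ k $ i\<bar>) * infnorm u" by (simp add: sum_distrib_right)
  also have "\<dots> \<le> c * infnorm u" using assms by (intro mult_right_mono infnorm_pos_le)
  finally show "\<bar>(Q *v u) $ k\<bar> \<le> c * infnorm u" .
qed

text \<open>The supremum over the unit ball is attained at the vector of signs of a row with
  the largest absolute sum.\<close>

lemma mat_infnorm_eq_Max_row_sum:
  fixes Q :: "real^'n^'m"
  shows "mat_infnorm Q = Max (range (\<lambda>k. \<Sum>i\<in>UNIV. \<bar>Q $ k $ i\<bar>))" (is "_ = ?M")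
proof (rule antisym)
  have row: "(\<Sum>i\<in>UNIV. \<bar>Q $ k $ i\<bar>) \<le> ?M" for k by (rule Max_ge) auto
  have M0: "?M \<ge> 0" using row[of undefined] by (smt (verit) sum_nonneg abs_ge_zero)
  have bound: "infnorm (Q *v u) \<le> ?M" if "infnorm u \<le> 1" for u
    using infnorm_matrix_vector_le_rows[of Q, OF row, of u] mult_left_mono[OF that M0] by simp
  then have bdd: "bdd_above ((\<lambda>u. infnorm (Q *v u)) ` {u. infnorm u \<le> 1})" by (intro bdd_aboveI2) auto
  show "mat_infnorm Q \<le> ?M" unfolding mat_infnorm_def
  proof (rule cSUP_least)
    show "{u::real^'n. infnorm u \<le> 1} \<noteq> {}" using infnorm_0 by (metis (mono_tags) empty_iff mem_Collect_eq zero_le_one)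
  qed (use bound in auto)
  show "?M \<le> mat_infnorm Q"
  proof (rule Max.boundedI)
    fix s assume "s \<in> range (\<lambda>k. \<Sum>i\<in>UNIV. \<bar>Q $ k $ i\<bar>)"
    then obtain k where s: "s = (\<Sum>i\<in>UNIV. \<bar>Q $ k $ i\<bar>)" by auto
    define u :: "real^'n" where "u = (\<chi> i. sgn (Q $ k $ i))"
    have u: "infnorm u \<le> 1" unfolding infnorm_le_iff_cart by (auto simp: u_def sgn_if)
    have "s = (Q *v u) $ k" unfolding s u_def matrix_vector_mult_def by (simp add: abs_sgn)
    also have "\<dots> \<le> infnorm (Q *v u)" using component_le_infnorm_cart abs_ge_self order_trans by blast
    also have "\<dots> \<le> mat_infnorm Q" unfolding mat_infnorm_def by (rule cSUP_upper[OF _ bdd]) (use u in auto)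
    finally show "s \<le> mat_infnorm Q" .
  qed auto
qed

lemma row_sum_le_mat_infnorm: "(\<Sum>i\<in>UNIV. \<bar>Q $ k $ i\<bar>) \<le> mat_infnorm (Q :: real^'n^'m)"
  unfolding mat_infnorm_eq_Max_row_sum by (rule Max_ge) auto

lemma entry_le_mat_infnorm: "\<bar>Q $ k $ i\<bar> \<le> mat_infnorm (Q :: real^'n^'m)"
  by (rule order_trans[OF member_le_sum row_sum_le_mat_infnorm]) auto

lemma mat_infnorm_nonneg: "0 \<le> mat_infnorm Q"
  using entry_le_mat_infnorm abs_ge_zero order_trans by blast

lemma infnorm_matrix_vector_le: "infnorm (Q *v u) \<le> mat_infnorm Q * infnorm u"
  by (rule infnorm_matrix_vector_le_rows[OF row_sum_le_mat_infnorm])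

lemma component_matrix_vector_le:
  assumes "mat_infnorm Q \<le> c" "infnorm u \<le> d"
  shows "\<bar>(Q *v u) $ p\<bar> \<le> c * d"
proof -
  have "\<bar>(Q *v u) $ p\<bar> \<le> mat_infnorm Q * infnorm u"
    using component_le_infnorm_cart infnorm_matrix_vector_le order_trans by blast
  also have "\<dots> \<le> c * d" using assms mat_infnorm_nonneg[of Q] by (intro mult_mono) (auto intro: infnorm_pos_le)
  finally show ?thesis .
qed

text \<open>For small \<open>h\<close> the diagonal entries of \<open>1 + h Q\<close> are nonnegative, so the difference quotient is
  eventually constant, equal to the largest of the row expressions on the left.  Hence the limit exists and is this
  maximum.\<close>

lemma log_infnorm_row_le:
  fixes Q :: "real^'n^'n"
  shows "Q $ k $ k + (\<Sum>i\<in>UNIV - {k}. \<bar>Q $ k $ i\<bar>) \<le> log_infnorm Q"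
proof -
  define r where "r k = Q $ k $ k + (\<Sum>i\<in>UNIV - {k}. \<bar>Q $ k $ i\<bar>)" for k
  define M where "M = Max (range r)"
  have "(mat_infnorm (mat 1 + h *\<^sub>R Q) - 1) / h = M" if h: "0 < h" "h < 1 / (mat_infnorm Q + 1)" for h
  proof -
    have "(\<Sum>i\<in>UNIV. \<bar>(mat 1 + h *\<^sub>R Q) $ k $ i\<bar>) = 1 + h * r k" for k
    proof -
      have "h * mat_infnorm Q \<le> 1"
        using h mat_infnorm_nonneg[of Q] by (simp add: field_simps)
      moreover have "h * \<bar>Q $ k $ k\<bar> \<le> h * mat_infnorm Q"
        using h entry_le_mat_infnorm by (intro mult_left_mono) auto
      ultimately have "\<bar>h * Q $ k $ k\<bar> \<le> 1" using h(1) unfolding abs_mult by linarith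
      then have d: "\<bar>1 + h * Q $ k $ k\<bar> = 1 + h * Q $ k $ k" by simp
      have "(\<Sum>i\<in>UNIV. \<bar>(mat 1 + h *\<^sub>R Q) $ k $ i\<bar>)
          = \<bar>(mat 1 + h *\<^sub>R Q) $ k $ k\<bar> + (\<Sum>i\<in>UNIV - {k}. \<bar>(mat 1 + h *\<^sub>R Q) $ k $ i\<bar>)"
        by (simp add: sum.remove)
      also have "\<dots> = \<bar>1 + h * Q $ k $ k\<bar> + (\<Sum>i\<in>UNIV - {k}. h * \<bar>Q $ k $ i\<bar>)"
        using h by (auto simp: mat_def abs_mult intro!: sum.cong)
      also have "\<dots> = 1 + h * r k" using d by (simp add: r_def distrib_left sum_distrib_left)
      finally show ?thesis .
    qed
    then have "mat_infnorm (mat 1 + h *\<^sub>R Q) = Max (range (\<lambda>k. 1 + h * r k))"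
      by (simp add: mat_infnorm_eq_Max_row_sum)
    also have "\<dots> = 1 + h * M"
    proof (rule antisym)
      have "r k \<le> M" for k unfolding M_def by (rule Max_ge) auto
      then show "Max (range (\<lambda>k. 1 + h * r k)) \<le> 1 + h * M" using h by auto
      have "M \<in> range r" unfolding M_def by (rule Max_in) auto
      then show "1 + h * M \<le> Max (range (\<lambda>k. 1 + h * r k))" by (intro Max_ge) auto
    qed
    finally show ?thesis using h by simp
  qed
  moreover have "1 / (mat_infnorm Q + 1) > 0" using mat_infnorm_nonneg[of Q] by simp
  ultimately have "\<forall>\<^sub>F h in at_right 0. (mat_infnorm (mat 1 + h *\<^sub>R Q) - 1) / h = M"
    unfolding eventually_at_right_field by blast
  then have "log_infnorm Q = M"
    unfolding log_infnorm_def by (intro tendsto_Lim tendsto_eventually) auto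
  moreover have "r k \<le> M" unfolding M_def by (rule Max_ge) auto
  ultimately show ?thesis by (simp add: r_def)
qed

text \<open>Boundedness of \<open>A\<close> is what makes the supremum finite; the inequality then follows by scaling
  both arguments to unit length.\<close>

lemma infnorm_bilin_le:
  fixes A :: "real^'n \<Rightarrow> real^'n^'m"
  assumes "bounded_linear A"
  shows "infnorm (A u *v w) \<le> bilin_infnorm (\<lambda>u w. A u *v w) * infnorm u * infnorm w"
proof -
  interpret bounded_linear A by fact
  obtain c where "c > 0" and c: "\<And>u. norm (A u) \<le> norm u * c" using pos_bounded by blast
  define C where "C = real CARD('n) * (sqrt DIM(real^'n) * c)"
  have "C \<ge> 0" using \<open>c > 0\<close> by (simp add: C_def)
  have bound: "infnorm (A u *v w) \<le> C" if "infnorm u \<le> 1" "infnorm w \<le> 1" for u w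
  proof -
    have "norm u \<le> sqrt DIM(real^'n) * 1"
      using norm_le_infnorm[of u] that(1) by (meson mult_left_mono order_trans real_sqrt_ge_zero of_nat_0_le_iff)
    then have nA: "norm (A u) \<le> sqrt DIM(real^'n) * c"
      using order_trans[OF c[of u] mult_right_mono[of "norm u" "sqrt DIM(real^'n)" c]] \<open>c > 0\<close> by simp
    have "(\<Sum>i\<in>UNIV. \<bar>A u $ k $ i\<bar>) \<le> C" for k
    proof -
      have "\<bar>A u $ k $ i\<bar> \<le> sqrt DIM(real^'n) * c" for i
        using component_le_norm_cart[of "A u $ k" i] Finite_Cartesian_Product.norm_nth_le[of "A u" k] nA by linarith
      then show ?thesis unfolding C_def by (intro sum_bounded_above[where A = UNIV, simplified]) auto
    qed
    then have "infnorm (A u *v w) \<le> C * infnorm w" by (rule infnorm_matrix_vector_le_rows)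
    also have "\<dots> \<le> C" using that \<open>C \<ge> 0\<close> by (simp add: mult_left_le)
    finally show ?thesis .
  qed
  have bdd: "bdd_above ((\<lambda>(u, w). infnorm (A u *v w)) ` ({u. infnorm u \<le> 1} \<times> {v. infnorm v \<le> 1}))"
    using bound by (intro bdd_aboveI2[where M = C]) auto
  have unit: "infnorm (A u *v w) \<le> bilin_infnorm (\<lambda>u w. A u *v w)" if "infnorm u \<le> 1" "infnorm w \<le> 1" for u w
    unfolding bilin_infnorm_def using cSUP_upper[OF _ bdd, of "(u, w)"] that by auto
  show ?thesis
  proof (cases "u = 0 \<or> w = 0")
    case True
    then show ?thesis by (auto simp: zero infnorm_0)
  next
    case False
    then have pos: "infnorm u > 0" "infnorm w > 0" by (auto simp: infnorm_pos_lt)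
    have "infnorm (A ((1 / infnorm u) *\<^sub>R u) *v ((1 / infnorm w) *\<^sub>R w)) \<le> bilin_infnorm (\<lambda>u w. A u *v w)"
      using pos by (intro unit) (auto simp: infnorm_mul)
    also have "A ((1 / infnorm u) *\<^sub>R u) *v ((1 / infnorm w) *\<^sub>R w) = (1 / (infnorm u * infnorm w)) *\<^sub>R (A u *v w)"
      by (simp add: scaleR scaleR_matrix_vector_assoc[symmetric] matrix_vector_mult_scaleR)
    finally show ?thesis using pos by (simp add: infnorm_mul field_simps)
  qed
qed

lemma bilin_infnorm_nonneg:
  fixes A :: "real^'n \<Rightarrow> real^'n^'m"
  assumes "bounded_linear A"
  shows "0 \<le> bilin_infnorm (\<lambda>u w. A u *v w)"
proof -
  have "infnorm (vec 1 :: real^'n) > 0" by (simp add: infnorm_pos_lt vec_eq_iff)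
  moreover have "0 \<le> bilin_infnorm (\<lambda>u w. A u *v w) * infnorm (vec 1 :: real^'n) * infnorm (vec 1 :: real^'n)"
    using infnorm_bilin_le[OF assms, of "vec 1" "vec 1"] infnorm_pos_le order_trans by blast
  ultimately show ?thesis by (simp add: zero_le_mult_iff)
qed

section \<open>Mean value estimates for twice differentiable fields\<close>

lemma C2_fun_has_derivative:
  assumes "C2_fun f"
  shows "(f has_derivative (\<lambda>u. D1 f z *v u)) (at z)"
proof -
  have "f differentiable (at z)"
    using assms unfolding C2_fun_def by (simp add: differentiable_on_def)
  then show ?thesis unfolding D1_def using jacobian_works by blast
qed

lemma has_derivative_component_cart:
  assumes "(f has_derivative f') F"
  shows "((\<lambda>z. f z $ p) has_derivative (\<lambda>u. f' u $ p)) F"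
  using bounded_linear.has_derivative[OF bounded_linear_vec_nth assms] by simp

lemma C2_fun_D1_has_derivative:
  assumes "C2_fun f"
  shows "(D1 f has_derivative frechet_derivative (D1 f) (at z)) (at z)"
proof -
  have "D1 f differentiable (at z)"
    using assms unfolding C2_fun_def by (simp add: differentiable_on_def)
  then show ?thesis by (simp add: frechet_derivative_works)
qed

lemma D2_component_le:
  assumes "C2_fun f" "bilin_infnorm (D2 f z) \<le> H" "infnorm w \<le> d"
  shows "\<bar>(D2 f z u w) $ p\<bar> \<le> H * d * infnorm u"
proof -
  have bl: "bounded_linear (frechet_derivative (D1 f) (at z))"
    using C2_fun_D1_has_derivative[OF assms(1)] has_derivative_bounded_linear by blast
  have D2: "D2 f z = (\<lambda>u w. frechet_derivative (D1 f) (at z) u *v w)" by (intro ext) (simp add: D2_def)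
  have "\<bar>(D2 f z u w) $ p\<bar> \<le> infnorm (D2 f z u w)" by (rule component_le_infnorm_cart)
  also have "\<dots> \<le> bilin_infnorm (D2 f z) * infnorm u * infnorm w"
    using infnorm_bilin_le[OF bl] unfolding D2 .
  also have "\<dots> \<le> H * infnorm u * d"
    using assms bilin_infnorm_nonneg[OF bl] unfolding D2[symmetric]
    by (intro mult_mono mult_nonneg_nonneg infnorm_pos_le) auto
  finally show ?thesis by (simp add: mult_ac)
qed

lemma D2_bound_nonneg:
  assumes "C2_fun f" "bilin_infnorm (D2 f z) \<le> H"
  shows "0 \<le> H"
proof -
  have bl: "bounded_linear (frechet_derivative (D1 f) (at z))"
    using C2_fun_D1_has_derivative[OF assms(1)] has_derivative_bounded_linear by blast
  have D2: "D2 f z = (\<lambda>u w. frechet_derivative (D1 f) (at z) u *v w)" by (intro ext) (simp add: D2_def)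
  show ?thesis using bilin_infnorm_nonneg[OF bl] assms(2) unfolding D2 by linarith
qed

lemma directional_derivative_has_derivative:
  fixes G :: "real^'n \<Rightarrow> real^'m" and F :: "real^'n \<Rightarrow> real^'n"
  assumes G: "C2_fun G" and F: "C2_fun F"
  shows "((\<lambda>z. (D1 G z *v F z) $ p) has_derivative
     (\<lambda>u. (D2 G z u (F z)) $ p + (D1 G z *v (D1 F z *v u)) $ p)) (at z)"
proof -
  have e: "((\<lambda>z. D1 G z $ p $ i) has_derivative (\<lambda>u. frechet_derivative (D1 G) (at z) u $ p $ i)) (at z)" for i
    by (intro has_derivative_component_cart C2_fun_D1_has_derivative G)
  have f: "((\<lambda>z. F z $ i) has_derivative (\<lambda>u. (D1 F z *v u) $ i)) (at z)" for i
    by (intro has_derivative_component_cart C2_fun_has_derivative F)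
  have "((\<lambda>z. \<Sum>i\<in>UNIV. D1 G z $ p $ i * F z $ i) has_derivative
     (\<lambda>u. \<Sum>i\<in>UNIV. D1 G z $ p $ i * (D1 F z *v u) $ i + frechet_derivative (D1 G) (at z) u $ p $ i * F z $ i)) (at z)"
    by (intro has_derivative_sum has_derivative_mult e f)
  then show ?thesis
    by (simp add: D2_def matrix_vector_mult_def sum.distrib add.commute)
qed

text \<open>The mean value theorem with equality holds only for scalar functions; this is the reason for working with
  single components throughout.\<close>

lemma convex_real_mean_value:
  fixes \<phi> :: "'a::real_normed_vector \<Rightarrow> real"
  assumes "convex B" "x \<in> B" "y \<in> B"
    and der: "\<And>z. z \<in> B \<Longrightarrow> (\<phi> has_derivative \<phi>' z) (at z)"
  obtains z where "z \<in> B" "\<phi> x - \<phi> y = \<phi>' z (x - y)"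
proof -
  have seg: "y + s *\<^sub>R (x - y) \<in> B" if "s \<in> {0..1}" for s
    using convexD_alt[OF assms(1,3,2), of s] that by (simp add: algebra_simps)
  have "((\<lambda>s. \<phi> (y + s *\<^sub>R (x - y))) has_derivative (\<lambda>h. \<phi>' (y + s *\<^sub>R (x - y)) (h *\<^sub>R (x - y)))) (at s within {0..1})"
    if "s \<in> {0..1}" for s :: real
    by (rule has_derivative_compose[where g = \<phi> and f = "\<lambda>s. y + s *\<^sub>R (x - y)", OF _ der[OF seg[OF that]]])
      (auto intro!: derivative_eq_intros)
  then obtain s where s: "s \<in> {0..1::real}"
    "\<phi> (y + 1 *\<^sub>R (x - y)) - \<phi> (y + 0 *\<^sub>R (x - y)) = \<phi>' (y + s *\<^sub>R (x - y)) ((1 - 0) *\<^sub>R (x - y))"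
    using mvt_very_simple[of 0 1 "\<lambda>s. \<phi> (y + s *\<^sub>R (x - y))"
        "\<lambda>s h. \<phi>' (y + s *\<^sub>R (x - y)) (h *\<^sub>R (x - y))"] by auto
  show thesis by (rule that[OF seg[OF s(1)]]) (use s(2) in simp)
qed

lemma convex_real_lipschitz:
  fixes \<phi> :: "real^'n \<Rightarrow> real"
  assumes "convex B" "x \<in> B" "y \<in> B"
    and "\<And>z. z \<in> B \<Longrightarrow> (\<phi> has_derivative \<phi>' z) (at z)"
    and "\<And>z u. z \<in> B \<Longrightarrow> \<bar>\<phi>' z u\<bar> \<le> M * infnorm u"
  shows "\<bar>\<phi> x - \<phi> y\<bar> \<le> M * infnorm (x - y)"
  using convex_real_mean_value[OF assms(1-4)] assms(5) by metis

lemma C2_component_lipschitz: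
  assumes "convex B" "x \<in> B" "y \<in> B" "C2_fun f" "\<And>z. z \<in> B \<Longrightarrow> mat_infnorm (D1 f z) \<le> L"
  shows "\<bar>f x $ p - f y $ p\<bar> \<le> L * infnorm (x - y)"
  by (rule convex_real_lipschitz[OF assms(1-3) has_derivative_component_cart[OF C2_fun_has_derivative[OF assms(4)]]])
    (use assms(5) component_matrix_vector_le in blast)

text \<open>The derivative of \<open>z \<mapsto> D1 G z *v F z\<close> has two parts, from \<open>D2 G\<close> and from \<open>D1 F\<close>; this is where
  the combinations \<open>HK + LL\<close> of the error formula come from.\<close>

lemma directional_derivative_lipschitz:
  fixes G :: "real^'n \<Rightarrow> real^'m" and F :: "real^'n \<Rightarrow> real^'n"
  assumes "convex B" "x \<in> B" "y \<in> B" and G: "C2_fun G" and F: "C2_fun F"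
    and "\<And>z. z \<in> B \<Longrightarrow> infnorm (F z) \<le> KF" "\<And>z. z \<in> B \<Longrightarrow> mat_infnorm (D1 F z) \<le> LF"
    and "\<And>z. z \<in> B \<Longrightarrow> mat_infnorm (D1 G z) \<le> LG" "\<And>z. z \<in> B \<Longrightarrow> bilin_infnorm (D2 G z) \<le> HG"
  shows "\<bar>(D1 G x *v F x) $ p - (D1 G y *v F y) $ p\<bar> \<le> (HG * KF + LG * LF) * infnorm (x - y)"
proof (rule convex_real_lipschitz[OF assms(1-3) directional_derivative_has_derivative[OF G F]])
  fix z u assume z: "z \<in> B"
  have "\<bar>(D2 G z u (F z)) $ p\<bar> \<le> HG * KF * infnorm u"
    using D2_component_le[OF G] assms(6,9) z by blast
  moreover have "infnorm (D1 F z *v u) \<le> LF * infnorm u"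
    by (rule order_trans[OF infnorm_matrix_vector_le]) (simp add: assms(7) z infnorm_pos_le mult_right_mono)
  then have "\<bar>(D1 G z *v (D1 F z *v u)) $ p\<bar> \<le> LG * (LF * infnorm u)"
    using component_matrix_vector_le assms(8) z by blast
  ultimately show "\<bar>(D2 G z u (F z)) $ p + (D1 G z *v (D1 F z *v u)) $ p\<bar> \<le> (HG * KF + LG * LF) * infnorm u"
    by (simp add: algebra_simps)
qed

section \<open>The function phi\<close>

lemma phi_pos: "phi s > 0"
  by (auto simp: phi_def divide_neg_neg zero_less_divide_iff)

lemma phi_le_exp_abs: "phi s \<le> exp \<bar>s\<bar>"
proof (cases s "0::real" rule: linorder_cases)
  case less
  have "1 + s \<le> exp s" by simp
  then have "phi s \<le> 1" using less by (simp add: phi_def field_simps)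
  then show ?thesis by (smt (verit) one_le_exp_iff)
next
  case equal then show ?thesis by (simp add: phi_def)
next
  case greater
  have "(1 - s) * exp s \<le> exp (- s) * exp s" using exp_ge_add_one_self[of "- s"] by (intro mult_right_mono) auto
  then have "exp s - 1 \<le> s * exp s" by (simp add: exp_minus_inverse algebra_simps)
  then show ?thesis using greater by (simp add: phi_def field_simps)
qed

text \<open>The function \<open>\<tau> \<mapsto> \<tau> phi (c \<tau>)\<close> is the solution of \<open>E' = 1 + c E\<close> with \<open>E 0 = 0\<close>.  This lemma and
  the next one say so without a case distinction on \<open>c = 0\<close>.\<close>

lemma mult_phi_eq: "1 + c * (\<tau> * phi (c * \<tau>)) = exp (c * \<tau>)"
  by (auto simp: phi_def)

lemma mult_phi_has_derivative:
  "((\<lambda>\<tau>. \<tau> * phi (c * \<tau>)) has_real_derivative exp (c * \<tau>)) (at \<tau> within S)"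
proof (cases "c = 0")
  case True
  have "(\<lambda>\<tau>. \<tau> * phi (c * \<tau>)) = (\<lambda>\<tau>. \<tau>)" using True by (simp add: phi_def)
  then show ?thesis using True by simp
next
  case False
  have "(\<lambda>\<tau>. \<tau> * phi (c * \<tau>)) = (\<lambda>\<tau>. (exp (c * \<tau>) - 1) / c)" using False by (auto simp: phi_def)
  then show ?thesis using False by (auto intro!: derivative_eq_intros)
qed

lemma mult_phi_mono:
  assumes "\<tau> \<le> \<tau>'" shows "\<tau> * phi (c * \<tau>) \<le> \<tau>' * phi (c * \<tau>')"
  by (rule DERIV_nonneg_imp_nondecreasing[OF assms]) (use mult_phi_has_derivative in \<open>force\<close>)

section \<open>Lipschitz functions with opposite end values\<close>

lemma antiperiodic_lipschitz_abs_le: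
  fixes U :: "real \<Rightarrow> real"
  assumes lip: "\<And>s t. s \<in> {a..b} \<Longrightarrow> t \<in> {a..b} \<Longrightarrow> \<bar>U t - U s\<bar> \<le> M * \<bar>t - s\<bar>"
    and anti: "U b = - U a" and t: "t \<in> {a..b}"
  shows "\<bar>U t\<bar> \<le> M * ((b - a) / 2)"
proof -
  have "\<bar>U t - U a\<bar> \<le> M * (t - a)" "\<bar>U t - U b\<bar> \<le> M * (b - t)"
    using lip[of a t] lip[of b t] t by auto
  then have "2 * \<bar>U t\<bar> \<le> M * (t - a) + M * (b - t)" using anti by linarith
  then show ?thesis by (simp add: algebra_simps)
qed

text \<open>Pair \<open>t\<close> with \<open>t + h/2\<close>.  If the two values have opposite signs, their absolute values add up to the increment
  between them.  If the signs agree, the opposite end values give the same bound \<open>M h/2\<close> by way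
  of the end points: going from \<open>t\<close> back to \<open>a\<close> and from \<open>t + h/2\<close> on to \<open>b\<close> takes a total time of \<open>h/2\<close> too.\<close>

lemma antiperiodic_lipschitz_integral_abs_le:
  fixes U :: "real \<Rightarrow> real"
  assumes "a \<le> b" and lip: "\<And>s t. s \<in> {a..b} \<Longrightarrow> t \<in> {a..b} \<Longrightarrow> \<bar>U t - U s\<bar> \<le> M * \<bar>t - s\<bar>"
    and anti: "U b = - U a" and cont: "continuous_on {a..b} U"
  shows "integral {a..b} (\<lambda>t. \<bar>U t\<bar>) \<le> M * (b - a)\<^sup>2 / 4"
proof -
  define h where "h = (b - a) / 2"
  have h: "h \<ge> 0" "b = a + h + h" using \<open>a \<le> b\<close> by (auto simp: h_def field_simps)
  have ci: "(\<lambda>t. \<bar>U t\<bar>) integrable_on {a..b}" "(\<lambda>t. \<bar>U t\<bar>) integrable_on {a..a+h}"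
    by (intro integrable_continuous_interval continuous_intros continuous_on_subset[OF cont]; use h in auto)+
  have ci2: "(\<lambda>t. \<bar>U (t + h)\<bar>) integrable_on {a..a+h}"
    by (intro integrable_continuous_interval continuous_on_rabs continuous_on_compose2[OF cont] continuous_intros)
      (use h in auto)
  have "integral {a..b} (\<lambda>t. \<bar>U t\<bar>) = integral {a..a+h} (\<lambda>t. \<bar>U t\<bar>) + integral {a+h..b} (\<lambda>t. \<bar>U t\<bar>)"
    using Henstock_Kurzweil_Integration.integral_combine[OF _ _ ci(1), of "a+h"] h by simp
  also have "integral {a+h..b} (\<lambda>t. \<bar>U t\<bar>) = integral {a..a+h} (\<lambda>t. \<bar>U (t + h)\<bar>)"
    using integral_shift_real_ivl[of "a+h" h b "\<lambda>t. \<bar>U t\<bar>"] h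
    by (simp add: add.commute)
  also have "integral {a..a+h} (\<lambda>t. \<bar>U t\<bar>) + \<dots> = integral {a..a+h} (\<lambda>t. \<bar>U t\<bar> + \<bar>U (t + h)\<bar>)"
    using ci(2) ci2 by (simp add: Henstock_Kurzweil_Integration.integral_add)
  also have "\<dots> \<le> integral {a..a+h} (\<lambda>t. M * h)"
  proof (rule integral_le)
    show "\<bar>U t\<bar> + \<bar>U (t + h)\<bar> \<le> M * h" if "t \<in> {a..a+h}" for t
    proof -
      have "\<bar>U (t + h) - U t\<bar> \<le> M * h" "\<bar>U t - U a\<bar> \<le> M * (t - a)" "\<bar>U b - U (t + h)\<bar> \<le> M * (b - (t + h))"
        using lip[of t "t+h"] lip[of a t] lip[of "t+h" b] that h by auto
      moreover have "M * (t - a) + M * (b - (t + h)) = M * h" using h(2) by (simp add: algebra_simps)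
      ultimately show ?thesis using anti by linarith
    qed
  qed (rule integrable_add[OF ci(2) ci2], rule integrable_const_ivl)
  also have "\<dots> = M * h * h" using h(1) by simp
  also have "\<dots> = M * (b - a)\<^sup>2 / 4" unfolding h_def by (simp add: power2_eq_square)
  finally show ?thesis .
qed

section \<open>Growth estimate by the logarithmic norm\<close>

text \<open>The row expression of \<open>log_infnorm_row_le\<close> bounds the growth of a component of size \<open>\<beta>\<close>.  A
  component that falls short of \<open>\<beta>\<close> costs a correction proportional to the gap, which tends to zero when the
  component reaches \<open>\<beta>\<close>.\<close>

lemma matrix_row_le_log_infnorm:
  fixes Q :: "real^'n^'n"
  assumes "log_infnorm Q \<le> \<Lambda>" "mat_infnorm Q \<le> L" and \<sigma>: "\<bar>\<sigma>\<bar> = 1" and u: "infnorm u \<le> \<beta>"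
  shows "\<sigma> * (Q *v u) $ p \<le> \<Lambda> * \<beta> + L * (\<beta> - \<sigma> * u $ p)"
proof -
  have comp: "\<bar>u $ i\<bar> \<le> \<beta>" for i using component_le_infnorm_cart u order_trans by blast
  have gap: "\<beta> - \<sigma> * u $ p \<ge> 0"
    using comp[of p] \<sigma> abs_ge_self[of "\<sigma> * u $ p"] by (simp add: abs_mult)
  have "\<beta> \<ge> 0" using comp[of p] by linarith
  have "\<sigma> * (Q *v u) $ p = Q $ p $ p * (\<sigma> * u $ p) + (\<Sum>i\<in>UNIV - {p}. \<sigma> * (Q $ p $ i * u $ i))"
    unfolding matrix_vector_mult_def
    by (simp add: sum.remove[of UNIV p] sum_distrib_left algebra_simps)
  also have "(\<Sum>i\<in>UNIV - {p}. \<sigma> * (Q $ p $ i * u $ i)) \<le> (\<Sum>i\<in>UNIV - {p}. \<bar>Q $ p $ i\<bar> * \<beta>)"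
  proof (rule sum_mono)
    fix i
    have "\<sigma> * (Q $ p $ i * u $ i) \<le> \<bar>\<sigma> * (Q $ p $ i * u $ i)\<bar>" by simp
    also have "\<dots> \<le> \<bar>Q $ p $ i\<bar> * \<beta>" using comp[of i] \<sigma> by (simp add: abs_mult mult_left_mono)
    finally show "\<sigma> * (Q $ p $ i * u $ i) \<le> \<bar>Q $ p $ i\<bar> * \<beta>" .
  qed
  also have "Q $ p $ p * (\<sigma> * u $ p) + (\<Sum>i\<in>UNIV - {p}. \<bar>Q $ p $ i\<bar> * \<beta>)
      = (Q $ p $ p + (\<Sum>i\<in>UNIV - {p}. \<bar>Q $ p $ i\<bar>)) * \<beta> + (- (Q $ p $ p)) * (\<beta> - \<sigma> * u $ p)"
    unfolding distrib_right sum_distrib_right by (simp add: right_diff_distrib)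
  also have "\<dots> \<le> \<Lambda> * \<beta> + L * (\<beta> - \<sigma> * u $ p)"
    using log_infnorm_row_le[of Q p] entry_le_mat_infnorm[of Q p p] assms(1,2) gap \<open>\<beta> \<ge> 0\<close>
    by (intro add_mono mult_right_mono) auto
  finally show ?thesis by simp
qed

text \<open>Comparison with the solution \<open>\<beta>\<close> of \<open>\<beta>' = \<Lambda> \<beta> + c + \<epsilon>\<close>, \<open>\<beta> a = \<epsilon>\<close>.  If the norm of \<open>u\<close> ever reached
  \<open>\<beta>\<close>, some component would do so at the first such time \<open>t1\<close>.  Shortly before \<open>t1\<close> the gap
  between \<open>\<beta>\<close> and this component is so small that the margin \<open>\<epsilon>\<close> outweighs the correction of the previous lemma,
  so the gap cannot decrease, although it has to close.  Since \<open>u\<close> need not be differentiable at \<open>t1\<close>, the monotonicity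
  is read off the integrals.  The matrix may depend on the component, as it does when it comes from the mean value
  theorem.\<close>

lemma log_infnorm_growth:
  fixes u u' :: "real \<Rightarrow> real^'n"
  assumes int: "\<And>p s t. a \<le> s \<Longrightarrow> s \<le> t \<Longrightarrow> t \<le> b \<Longrightarrow>
      ((\<lambda>\<tau>. u' \<tau> $ p) has_integral (u t $ p - u s $ p)) {s..t}"
    and cont: "continuous_on {a..b} u" and u0: "u a = 0"
    and lin: "\<And>t p. t \<in> {a..b} \<Longrightarrow>
      \<exists>Q. log_infnorm Q \<le> \<Lambda> \<and> mat_infnorm Q \<le> L \<and> \<bar>u' t $ p - (Q *v u t) $ p\<bar> \<le> c"
    and t: "t \<in> {a..b}"
  shows "infnorm (u t) \<le> c * ((t - a) * phi (\<Lambda> * (t - a)))"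
proof -
  define E where "E s = (s - a) * phi (\<Lambda> * (s - a))" for s
  have E': "(E has_real_derivative exp (\<Lambda> * (s - a))) (at s within S)" for s S
  proof -
    have "((\<lambda>s. s - a) has_real_derivative 1) (at s within S)" by (auto intro!: derivative_eq_intros)
    from DERIV_chain'[OF this mult_phi_has_derivative[of \<Lambda> "s - a" UNIV]]
    show ?thesis unfolding E_def by simp
  qed
  have expE: "exp (\<Lambda> * (s - a)) = 1 + \<Lambda> * E s" for s
    unfolding E_def using mult_phi_eq[of \<Lambda> "s - a"] by simp
  have L0: "L \<ge> 0" and c0: "c \<ge> 0" using lin[OF t] mat_infnorm_nonneg order_trans abs_ge_zero by blast+
  have E0: "E s \<ge> 0" if "s \<ge> a" for s using that phi_pos[of "\<Lambda> * (s - a)"] by (simp add: E_def)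
  have strict: "infnorm (u t) < (c + \<epsilon>) * E t + \<epsilon> * exp (\<Lambda> * (t - a))"
    if \<epsilon>: "\<epsilon> > 0" and t: "t \<in> {a..b}" for \<epsilon> t
  proof (rule ccontr)
    define \<beta> where "\<beta> s = (c + \<epsilon>) * E s + \<epsilon> * exp (\<Lambda> * (s - a))" for s
    assume "\<not> ?thesis"
    then have "\<beta> t \<le> infnorm (u t)" by (simp add: \<beta>_def)
    have \<beta>': "(\<beta> has_real_derivative (\<Lambda> * \<beta> s + (c + \<epsilon>))) (at s within S)" for s S
      unfolding \<beta>_def[abs_def]
      by ((rule derivative_eq_intros E' refl)+, simp only: expE, simp add: algebra_simps)
    have cont\<beta>: "continuous_on S \<beta>" for S by (rule DERIV_continuous_on[OF \<beta>'])
    define S where "S = {s \<in> {a..b}. \<beta> s \<le> infnorm (u s)}"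
    have "closed S" unfolding S_def
      by (intro continuous_on_closed_Collect_le continuous_on_infnorm cont cont\<beta> closed_atLeastAtMost)
    have "S \<noteq> {}" "bdd_below S" using t \<open>\<beta> t \<le> _\<close> by (auto simp: S_def intro: bdd_belowI[where m = a])
    define t1 where "t1 = Inf S"
    have "t1 \<in> S" unfolding t1_def by (rule closed_contains_Inf) fact+
    then have t1: "t1 \<in> {a..b}" "\<beta> t1 \<le> infnorm (u t1)" by (auto simp: S_def)
    have before: "infnorm (u s) < \<beta> s" if "a \<le> s" "s < t1" for s
    proof -
      have "s \<notin> S" using cInf_lower[OF _ \<open>bdd_below S\<close>, of s] that by (auto simp: t1_def)
      then show ?thesis using that t1 by (auto simp: S_def)
    qed
    have "\<beta> a = \<epsilon>" by (simp add: \<beta>_def E_def)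
    then have "a < t1" using t1 \<epsilon> u0 by (cases "t1 = a") (auto simp: infnorm_0)
    obtain p where p: "infnorm (u t1) = \<bar>u t1 $ p\<bar>" by (rule infnorm_attained_cart)
    define \<sigma> :: real where "\<sigma> = (if u t1 $ p \<ge> 0 then 1 else -1)"
    have \<sigma>: "\<bar>\<sigma>\<bar> = 1" "\<sigma> * u t1 $ p = infnorm (u t1)" by (auto simp: \<sigma>_def p)
    define \<psi> where "\<psi> s = \<beta> s - \<sigma> * u s $ p" for s
    have "continuous_on {a..b} \<psi>" unfolding \<psi>_def by (intro continuous_intros cont cont\<beta>)
    moreover have "\<psi> t1 \<le> 0" using t1 \<sigma> by (simp add: \<psi>_def)
    moreover have "\<epsilon> / (L + 1) > 0" using \<epsilon> L0 by simp
    ultimately obtain d where d: "d > 0" "\<And>s. s \<in> {a..b} \<Longrightarrow> dist s t1 < d \<Longrightarrow> dist (\<psi> s) (\<psi> t1) < \<epsilon> / (L + 1)"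
      using t1(1) unfolding continuous_on_iff by meson
    \<comment> \<open>On the open interval from \<open>t0\<close> to \<open>t1\<close> the norm is below \<open>\<beta>\<close> and the gap \<open>\<psi>\<close> is small.\<close>
    define t0 where "t0 = max a (t1 - d / 2)"
    have t0: "a \<le> t0" "t0 < t1" using \<open>a < t1\<close> d by (auto simp: t0_def)
    have small: "L * \<psi> s \<le> \<epsilon>" if "s \<in> {t0<..<t1}" for s
    proof -
      have "\<psi> s < \<epsilon> / (L + 1)"
        using d(2)[of s] that t1 t0 \<open>\<psi> t1 \<le> 0\<close> d(1) by (auto simp: dist_real_def t0_def)
      then have "(L + 1) * \<psi> s < \<epsilon>" using L0 by (simp add: field_simps)
      moreover have "\<psi> s \<ge> 0"
      proof -
        have "\<sigma> * u s $ p \<le> \<bar>u s $ p\<bar>"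
        using \<sigma>(1) abs_ge_self[of "\<sigma> * u s $ p"] by (simp add: abs_mult)
        also have "\<dots> \<le> \<beta> s" using before[of s] that t0 component_le_infnorm_cart[of "u s" p] by auto
        finally show ?thesis by (simp add: \<psi>_def)
      qed
      ultimately show ?thesis by (simp add: algebra_simps)
    qed
    have "((\<lambda>s. (\<Lambda> * \<beta> s + (c + \<epsilon>)) - \<sigma> * u' s $ p) has_integral
        ((\<beta> t1 - \<beta> t0) - \<sigma> * (u t1 $ p - u t0 $ p))) {t0..t1}"
    proof (intro has_integral_diff has_integral_mult_right int)
      show "((\<lambda>s. \<Lambda> * \<beta> s + (c + \<epsilon>)) has_integral (\<beta> t1 - \<beta> t0)) {t0..t1}"
        using \<beta>' t0 by (intro fundamental_theorem_of_calculus)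
          (auto simp: has_real_derivative_iff_has_vector_derivative[symmetric])
    qed (use t0 t1 in auto)
    then have "((\<lambda>s. (\<Lambda> * \<beta> s + (c + \<epsilon>)) - \<sigma> * u' s $ p) has_integral (\<psi> t1 - \<psi> t0)) {t0<..<t1}"
      by (simp add: has_integral_Icc_iff_Ioo \<psi>_def algebra_simps)
    then have "0 \<le> \<psi> t1 - \<psi> t0"
    proof (rule has_integral_nonneg)
      fix s assume s: "s \<in> {t0<..<t1}"
      then have sab: "s \<in> {a..b}" using t0 t1 by auto
      obtain Q where Q: "log_infnorm Q \<le> \<Lambda>" "mat_infnorm Q \<le> L" "\<bar>u' s $ p - (Q *v u s) $ p\<bar> \<le> c"
        using lin[OF sab] by blast
      have "\<sigma> * u' s $ p \<le> \<sigma> * (Q *v u s) $ p + c"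
        using Q(3) by (auto simp: \<sigma>_def)
      also have "\<sigma> * (Q *v u s) $ p \<le> \<Lambda> * \<beta> s + L * \<psi> s"
        unfolding \<psi>_def using before[of s] s t0 by (intro matrix_row_le_log_infnorm Q \<sigma>) auto
      finally show "0 \<le> (\<Lambda> * \<beta> s + (c + \<epsilon>)) - \<sigma> * u' s $ p" using small[OF s] by linarith
    qed
    moreover have "\<psi> t0 > 0"
    proof -
      have "\<sigma> * u t0 $ p \<le> \<bar>u t0 $ p\<bar>"
        using \<sigma>(1) abs_ge_self[of "\<sigma> * u t0 $ p"] by (simp add: abs_mult)
      also have "\<dots> < \<beta> t0" using before[OF t0] component_le_infnorm_cart[of "u t0" p] by linarith
      finally show ?thesis by (simp add: \<psi>_def)
    qed
    ultimately show False using \<open>\<psi> t1 \<le> 0\<close> by linarith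
  qed
  have "infnorm (u t) \<le> c * E t"
  proof (rule field_le_epsilon)
    fix \<eta> :: real assume "\<eta> > 0"
    define R where "R = E t + exp (\<Lambda> * (t - a))"
    have "R > 0" using E0[of t] t by (simp add: R_def add_nonneg_pos)
    then have "infnorm (u t) < (c + \<eta> / R) * E t + \<eta> / R * exp (\<Lambda> * (t - a))"
      using strict[of "\<eta> / R" t] t \<open>\<eta> > 0\<close> by simp
    also have "\<dots> = c * E t + \<eta> / R * R" unfolding R_def distrib_left distrib_right by simp
    finally show "infnorm (u t) \<le> c * E t + \<eta>" using \<open>R > 0\<close> by simp
  qed
  then show ?thesis by (simp add: E_def)
qed

section \<open>Functions along a trajectory\<close>

lemma abs_continuous_on_lipschitz_compose:
  fixes x :: "real \<Rightarrow> 'a::real_normed_vector" and G :: "'a \<Rightarrow> 'b::real_normed_vector"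
  assumes ac: "abs_continuous_on a b x" and sub: "{s..t} \<subseteq> {a..b}"
    and lip: "\<And>p q. p \<in> {s..t} \<Longrightarrow> q \<in> {s..t} \<Longrightarrow> norm (G (x p) - G (x q)) \<le> M * norm (x p - x q)"
  shows "abs_continuous_on s t (\<lambda>\<tau>. G (x \<tau>))"
  unfolding abs_continuous_on_def
proof (intro allI impI)
  fix e :: real assume "e > 0"
  define M' where "M' = \<bar>M\<bar> + 1"
  have "e / M' > 0" using \<open>e > 0\<close> by (simp add: M'_def)
  then obtain d where "d > 0" and d: "\<And>\<D> S. \<D> division_of S \<Longrightarrow> S \<subseteq> {a..b} \<Longrightarrow>
      (\<Sum>I\<in>\<D>. Sup I - Inf I) < d \<Longrightarrow> (\<Sum>I\<in>\<D>. norm (x (Sup I) - x (Inf I))) < e / M'"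
    using ac unfolding abs_continuous_on_def by metis
  have est: "(\<Sum>I\<in>\<D>. norm (G (x (Sup I)) - G (x (Inf I)))) < e"
    if \<D>: "\<D> division_of S" "S \<subseteq> {s..t}" "(\<Sum>I\<in>\<D>. Sup I - Inf I) < d" for \<D> S
  proof -
    have "norm (G (x (Sup I)) - G (x (Inf I))) \<le> M' * norm (x (Sup I) - x (Inf I))" if I: "I \<in> \<D>" for I
    proof -
      obtain c c' where "I = {c..c'}" using division_ofD(4)[OF \<D>(1) I] by auto
      moreover have "I \<noteq> {}" "I \<subseteq> {s..t}" using division_ofD(2,3)[OF \<D>(1) I] \<D>(2) by auto
      ultimately have "Sup I \<in> {s..t}" "Inf I \<in> {s..t}" by auto
      then have "norm (G (x (Sup I)) - G (x (Inf I))) \<le> M * norm (x (Sup I) - x (Inf I))" by (rule lip)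
      also have "\<dots> \<le> M' * norm (x (Sup I) - x (Inf I))" by (intro mult_right_mono) (auto simp: M'_def)
      finally show ?thesis .
    qed
    then have "(\<Sum>I\<in>\<D>. norm (G (x (Sup I)) - G (x (Inf I)))) \<le> M' * (\<Sum>I\<in>\<D>. norm (x (Sup I) - x (Inf I)))"
      unfolding sum_distrib_left by (rule sum_mono)
    also have "\<dots> < M' * (e / M')"
      using d[OF \<D>(1) subset_trans[OF \<D>(2) sub] \<D>(3)] by (intro mult_strict_left_mono) (auto simp: M'_def)
    also have "\<dots> = e" by (simp add: M'_def)
    finally show ?thesis .
  qed
  show "\<exists>d>0. \<forall>\<D> S. \<D> division_of S \<and> S \<subseteq> {s..t} \<and> (\<Sum>I\<in>\<D>. Sup I - Inf I) < d \<longrightarrow>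
      (\<Sum>I\<in>\<D>. norm (G (x (Sup I)) - G (x (Inf I)))) < e"
  proof (intro exI[of _ d] conjI allI impI, goal_cases)
    case 1 show ?case by (rule \<open>d > 0\<close>)
  next
    case (2 \<D> S)
    then have "\<D> division_of S" "S \<subseteq> {s..t}" "(\<Sum>I\<in>\<D>. Sup I - Inf I) < d" by blast+
    then show ?case by (rule est)
  qed
qed

text \<open>Along a trajectory the chain rule is available almost everywhere only, but a function that is Lipschitz on \<open>B\<close>
  keeps the trajectory absolutely continuous, so the integrated form holds without exception.\<close>

lemma solution_chain_rule:
  fixes G :: "real^'n \<Rightarrow> real"
  assumes sol: "input_affine_solution f g v a b x"
    and B: "convex B" "x ` {a..b} \<subseteq> B"
    and der: "\<And>z. z \<in> B \<Longrightarrow> (G has_derivative G' z) (at z)"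
    and bnd: "\<And>z u. z \<in> B \<Longrightarrow> \<bar>G' z u\<bar> \<le> M * infnorm u"
    and st: "a \<le> s" "s \<le> t" "t \<le> b"
  shows "((\<lambda>\<tau>. G' (x \<tau>) (f (x \<tau>) + (\<Sum>i\<in>UNIV. v i \<tau> *\<^sub>R g i (x \<tau>)))) has_integral (G (x t) - G (x s))) {s..t}"
proof -
  have sub: "{s..t} \<subseteq> {a..b}" using st by auto
  have acx: "abs_continuous_on a b x" using sol by (simp add: input_affine_solution_def)
  have "AE \<tau> in lebesgue. \<tau> \<in> {a..b} \<longrightarrow>
      (x has_vector_derivative (f (x \<tau>) + (\<Sum>i\<in>UNIV. v i \<tau> *\<^sub>R g i (x \<tau>)))) (at \<tau> within {a..b})"
    using sol unfolding input_affine_solution_def by (subst (asm) AE_restrict_space_iff) auto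
  then obtain N where N: "negligible N" and xd: "\<And>\<tau>. \<tau> \<in> {a..b} \<Longrightarrow> \<tau> \<notin> N \<Longrightarrow>
      (x has_vector_derivative (f (x \<tau>) + (\<Sum>i\<in>UNIV. v i \<tau> *\<^sub>R g i (x \<tau>)))) (at \<tau> within {a..b})"
    unfolding eventually_ae_filter_negligible by blast
  have "norm (G (x p) - G (x q)) \<le> \<bar>M\<bar> * norm (x p - x q)" if "p \<in> {s..t}" "q \<in> {s..t}" for p q
  proof -
    have "\<bar>G (x p) - G (x q)\<bar> \<le> M * infnorm (x p - x q)"
      using that sub B(2) by (intro convex_real_lipschitz[OF B(1) _ _ der bnd]) auto
    also have "\<dots> \<le> \<bar>M\<bar> * norm (x p - x q)"
      by (intro mult_mono infnorm_le_norm infnorm_pos_le) auto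
    finally show ?thesis by simp
  qed
  then have ac: "abs_continuous_on s t (\<lambda>\<tau>. G (x \<tau>))"
    using abs_continuous_on_lipschitz_compose[OF acx sub, of G "\<bar>M\<bar>"] by simp
  show ?thesis
  proof (rule abs_continuous_has_integral_derivative[OF st(2) ac N])
    fix \<tau> assume \<tau>: "\<tau> \<in> {s..t}" "\<tau> \<notin> N"
    let ?X = "f (x \<tau>) + (\<Sum>i\<in>UNIV. v i \<tau> *\<^sub>R g i (x \<tau>))"
    have "(x has_derivative (\<lambda>h. h *\<^sub>R ?X)) (at \<tau> within {s..t})"
      using has_vector_derivative_within_subset[OF xd sub, of \<tau>] \<tau> sub unfolding has_vector_derivative_def by auto
    moreover have D: "(G has_derivative G' (x \<tau>)) (at (x \<tau>))" using der \<tau> sub B(2) by blast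
    ultimately have "((\<lambda>\<tau>. G (x \<tau>)) has_derivative (\<lambda>h. G' (x \<tau>) (h *\<^sub>R ?X))) (at \<tau> within {s..t})"
      using has_derivative_compose[of x _ \<tau> "{s..t}" G "G' (x \<tau>)"] by blast
    moreover have "G' (x \<tau>) (h *\<^sub>R ?X) = h *\<^sub>R G' (x \<tau>) ?X" for h
      using linear_scale[OF has_derivative_linear[OF D]] .
    ultimately show "((\<lambda>\<tau>. G (x \<tau>)) has_vector_derivative G' (x \<tau>) ?X) (at \<tau> within {s..t})"
      unfolding has_vector_derivative_def by simp
  qed
qed

section \<open>Bounds for a single trajectory\<close>

text \<open>Convexity of \<open>B\<close> is for the mean value estimates; a point of \<open>B\<close> makes the constants nonnegative.\<close>

locale bounded_affine_system =
  fixes f :: "real^'n \<Rightarrow> real^'n" and g :: "'m::finite \<Rightarrow> real^'n \<Rightarrow> real^'n"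
    and B :: "(real^'n) set" and V Kg Lg Hg :: "'m \<Rightarrow> real" and K \<Lambda> L H :: real
  assumes convex: "convex B" and nonempty: "B \<noteq> {}"
    and C2: "C2_fun f" "\<And>i. C2_fun (g i)"
    and bounds: "field_bounds B f g K Kg \<Lambda> L Lg H Hg"
    and V_nonneg: "\<And>i. V i \<ge> 0"
begin

definition K' where "K' = (\<Sum>i\<in>UNIV. V i * Kg i)"
definition L' where "L' = (\<Sum>i\<in>UNIV. V i * Lg i)"
definition H' where "H' = (\<Sum>i\<in>UNIV. V i * Hg i)"

lemma f_bounds:
  assumes "z \<in> B"
  shows "infnorm (f z) \<le> K" "log_infnorm (D1 f z) \<le> \<Lambda>" "mat_infnorm (D1 f z) \<le> L"
    "bilin_infnorm (D2 f z) \<le> H"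
  using bounds assms unfolding field_bounds_def by auto

lemma g_bounds:
  assumes "z \<in> B"
  shows "infnorm (g i z) \<le> Kg i" "mat_infnorm (D1 (g i) z) \<le> Lg i" "bilin_infnorm (D2 (g i) z) \<le> Hg i"
  using bounds assms unfolding field_bounds_def by auto

lemma constants_nonneg:
  "0 \<le> K" "0 \<le> L" "0 \<le> H" "0 \<le> Kg i" "0 \<le> Lg i" "0 \<le> Hg i" "0 \<le> K'" "0 \<le> L'" "0 \<le> H'"
proof -
  obtain z where z: "z \<in> B" using nonempty by blast
  show "0 \<le> K" "0 \<le> L" using f_bounds[OF z] infnorm_pos_le mat_infnorm_nonneg order_trans by blast+
  show "0 \<le> H" by (rule D2_bound_nonneg[OF C2(1) f_bounds(4)[OF z]])
  have *: "0 \<le> Kg i" "0 \<le> Lg i" for i using g_bounds[OF z] infnorm_pos_le mat_infnorm_nonneg order_trans by blast+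
  have **: "0 \<le> Hg i" for i by (rule D2_bound_nonneg[OF C2(2) g_bounds(3)[OF z]])
  show "0 \<le> Kg i" "0 \<le> Lg i" "0 \<le> Hg i" by (fact * **)+
  show "0 \<le> K'" "0 \<le> L'" "0 \<le> H'"
    unfolding K'_def L'_def H'_def using * ** V_nonneg by (auto intro!: sum_nonneg)
qed

definition rhs :: "('m \<Rightarrow> real) \<Rightarrow> real^'n \<Rightarrow> real^'n" where
  "rhs c z = f z + (\<Sum>i\<in>UNIV. c i *\<^sub>R g i z)"

text \<open>The factor \<open>\<rho>\<close> is \<open>1\<close> for the original inputs and \<open>r\<close> for those of the auxiliary system.\<close>

lemma control_part_le:
  assumes "z \<in> B" "\<And>i. \<bar>c i\<bar> \<le> \<rho> * V i"
  shows "infnorm (\<Sum>i\<in>UNIV. c i *\<^sub>R g i z) \<le> \<rho> * K'"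
  unfolding infnorm_le_iff_cart
proof
  fix p
  have "\<bar>(\<Sum>i\<in>UNIV. c i *\<^sub>R g i z) $ p\<bar> \<le> (\<Sum>i\<in>UNIV. \<bar>c i * g i z $ p\<bar>)" by simp
  also have "\<dots> \<le> (\<Sum>i\<in>UNIV. \<rho> * (V i * Kg i))"
  proof (rule sum_mono)
    fix i
    have "\<bar>g i z $ p\<bar> \<le> Kg i" using component_le_infnorm_cart g_bounds(1)[OF assms(1)] order_trans by blast
    then have "\<bar>c i\<bar> * \<bar>g i z $ p\<bar> \<le> (\<rho> * V i) * Kg i"
      using assms(2)[of i] by (intro mult_mono) auto
    then show "\<bar>c i * g i z $ p\<bar> \<le> \<rho> * (V i * Kg i)" by (simp add: abs_mult mult.assoc)
  qed
  also have "\<dots> = \<rho> * K'" by (simp add: K'_def sum_distrib_left)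
  finally show "\<bar>(\<Sum>i\<in>UNIV. c i *\<^sub>R g i z) $ p\<bar> \<le> \<rho> * K'" .
qed

lemma rhs_le:
  assumes "z \<in> B" "\<And>i. \<bar>c i\<bar> \<le> \<rho> * V i"
  shows "infnorm (rhs c z) \<le> K + \<rho> * K'"
  unfolding rhs_def
  using infnorm_triangle[of "f z" "\<Sum>i\<in>UNIV. c i *\<^sub>R g i z"] f_bounds(1)[OF assms(1)]
    control_part_le[OF assms] by linarith

lemma directional_Lipschitz:
  assumes "z \<in> B" "z' \<in> B"
  shows "\<bar>(D1 f z *v f z) $ p - (D1 f z' *v f z') $ p\<bar> \<le> (H * K + L * L) * infnorm (z - z')"
    and "\<bar>(D1 f z *v g i z) $ p - (D1 f z' *v g i z') $ p\<bar> \<le> (H * Kg i + L * Lg i) * infnorm (z - z')"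
    and "\<bar>(D1 (g i) z *v f z) $ p - (D1 (g i) z' *v f z') $ p\<bar> \<le> (Hg i * K + Lg i * L) * infnorm (z - z')"
  by (rule directional_derivative_lipschitz[OF convex assms]; use C2 f_bounds g_bounds in blast)+

lemma component_chain_rule:
  assumes sol: "input_affine_solution f g v a b x" and xB: "x ` {a..b} \<subseteq> B"
    and F: "C2_fun F" "\<And>z. z \<in> B \<Longrightarrow> mat_infnorm (D1 F z) \<le> M"
    and st: "a \<le> s" "s \<le> t" "t \<le> b"
  shows "((\<lambda>\<tau>. (D1 F (x \<tau>) *v rhs (\<lambda>i. v i \<tau>) (x \<tau>)) $ p) has_integral (F (x t) $ p - F (x s) $ p)) {s..t}"
  unfolding rhs_def
  by (rule solution_chain_rule[OF sol convex xB has_derivative_component_cart[OF C2_fun_has_derivative[OF F(1)]] _ st])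
    (use F(2) component_matrix_vector_le in blast)

lemma solution_component_integral:
  assumes sol: "input_affine_solution f g v a b x" and xB: "x ` {a..b} \<subseteq> B"
    and st: "a \<le> s" "s \<le> t" "t \<le> b"
  shows "((\<lambda>\<tau>. rhs (\<lambda>i. v i \<tau>) (x \<tau>) $ p) has_integral (x t $ p - x s $ p)) {s..t}"
  unfolding rhs_def
proof (rule solution_chain_rule[where G = "\<lambda>z. z $ p" and G' = "\<lambda>z u. u $ p" and M = 1, OF sol convex xB _ _ st])
  show "((\<lambda>z. z $ p) has_derivative (\<lambda>u. u $ p)) (at z)" for z :: "real^'n"
    by (rule bounded_linear_imp_has_derivative[OF bounded_linear_vec_nth])
qed (simp add: component_le_infnorm_cart)

lemma solution_lipschitz:
  assumes sol: "input_affine_solution f g v a b x" and xB: "x ` {a..b} \<subseteq> B"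
    and v: "\<And>i t. t \<in> {a..b} \<Longrightarrow> \<bar>v i t\<bar> \<le> \<rho> * V i"
    and st: "s \<in> {a..b}" "t \<in> {a..b}"
  shows "infnorm (x t - x s) \<le> (K + \<rho> * K') * \<bar>t - s\<bar>"
  unfolding infnorm_le_iff_cart
proof
  fix p
  have b: "\<bar>rhs (\<lambda>i. v i \<tau>) (x \<tau>) $ p\<bar> \<le> K + \<rho> * K'" if "\<tau> \<in> {a..b}" for \<tau>
    using component_le_infnorm_cart rhs_le[of "x \<tau>" "\<lambda>i. v i \<tau>" \<rho>] v[OF that] xB that order_trans by blast
  show "\<bar>(x t - x s) $ p\<bar> \<le> (K + \<rho> * K') * \<bar>t - s\<bar>"
    using indefinite_integral_lipschitz[OF solution_component_integral[OF sol xB] b st] by simp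
qed

lemma solution_continuous:
  assumes sol: "input_affine_solution f g v a b x" and xB: "x ` {a..b} \<subseteq> B"
    and v: "\<And>i t. t \<in> {a..b} \<Longrightarrow> \<bar>v i t\<bar> \<le> \<rho> * V i"
  shows "continuous_on {a..b} x"
proof -
  define C where "C = sqrt DIM(real^'n) * \<bar>K + \<rho> * K'\<bar>"
  have "norm (x t - x s) \<le> C * norm (t - s)" if "s \<in> {a..b}" "t \<in> {a..b}" for s t
  proof -
    have "norm (x t - x s) \<le> sqrt DIM(real^'n) * infnorm (x t - x s)" by (rule norm_le_infnorm)
    also have "\<dots> \<le> sqrt DIM(real^'n) * (\<bar>K + \<rho> * K'\<bar> * \<bar>t - s\<bar>)"
      by (intro mult_left_mono order_trans[OF solution_lipschitz[OF sol xB v that]] mult_right_mono) auto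
    finally show ?thesis by (simp add: C_def mult.assoc)
  qed
  then have "C-lipschitz_on {a..b} x"
    by (intro lipschitz_onI) (auto simp: dist_norm C_def)
  then show ?thesis by (rule lipschitz_on_continuous_on)
qed

end

section \<open>Comparison of the two trajectories over one step\<close>

locale coupled_step = bounded_affine_system f g B V Kg Lg Hg K \<Lambda> L H
  for f :: "real^'n \<Rightarrow> real^'n" and g :: "'m::finite \<Rightarrow> real^'n \<Rightarrow> real^'n"
    and B and V Kg Lg Hg :: "'m \<Rightarrow> real" and K \<Lambda> L H :: real +
  fixes a b r :: real and v w :: "'m \<Rightarrow> real \<Rightarrow> real" and x y :: "real \<Rightarrow> real^'n"
  assumes ab: "a < b" and r_nonneg: "0 \<le> r"
    and v_bound: "\<And>i t. t \<in> {a..b} \<Longrightarrow> \<bar>v i t\<bar> \<le> V i"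
    and w_bound: "\<And>i t. t \<in> {a..b} \<Longrightarrow> \<bar>w i t\<bar> \<le> r * V i"
    and v_int: "\<And>i. v i integrable_on {a..b}" and w_int: "\<And>i. w i integrable_on {a..b}"
    and moment0: "\<And>i. integral {a..b} (\<lambda>t. v i t - w i t) = 0"
    and moment1: "\<And>i. integral {a..b} (\<lambda>t. (t - (a + b) / 2) * (v i t - w i t)) = 0"
    and x_sol: "input_affine_solution f g v a b x" and y_sol: "input_affine_solution f g w a b y"
    and init: "x a = y a" and xB: "x ` {a..b} \<subseteq> B" and yB: "y ` {a..b} \<subseteq> B"
begin

abbreviation h where "h \<equiv> b - a"
abbreviation mid where "mid \<equiv> (a + b) / 2"

text \<open>A bound for the distance of the trajectories on the whole step.\<close>

definition D where "D = (1 + r) * K' * (h * phi (\<Lambda> * h))"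

lemma v_bound1: "t \<in> {a..b} \<Longrightarrow> \<bar>v i t\<bar> \<le> 1 * V i"
  using v_bound by simp

lemma in_B: "t \<in> {a..b} \<Longrightarrow> x t \<in> B" "t \<in> {a..b} \<Longrightarrow> y t \<in> B"
  using xB yB by auto

lemma D_nonneg: "0 \<le> D"
  using r_nonneg constants_nonneg(7) ab phi_pos[of "\<Lambda> * h"] by (simp add: D_def)

text \<open>The difference of the trajectories obeys the growth estimate: the drift contributes
  \<open>Df\<close> at an intermediate point applied to the difference, the controls a perturbation of size at most \<open>(1 + r) K'\<close>.\<close>

lemma trajectories_close:
  assumes t: "t \<in> {a..b}"
  shows "infnorm (x t - y t) \<le> D"
proof -
  have "infnorm (x t - y t) \<le> ((1 + r) * K') * ((t - a) * phi (\<Lambda> * (t - a)))"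
  proof (rule log_infnorm_growth[where u = "\<lambda>t. x t - y t" and b = b and L = L and a = a and t = t
        and u' = "\<lambda>t. rhs (\<lambda>i. v i t) (x t) - rhs (\<lambda>i. w i t) (y t)", OF _ _ _ _ t])
    show "((\<lambda>\<tau>. (rhs (\<lambda>i. v i \<tau>) (x \<tau>) - rhs (\<lambda>i. w i \<tau>) (y \<tau>)) $ p) has_integral
        ((x t - y t) $ p - (x s - y s) $ p)) {s..t}" if "a \<le> s" "s \<le> t" "t \<le> b" for p s t
      using has_integral_diff[OF solution_component_integral[OF x_sol xB that, of p]
          solution_component_integral[OF y_sol yB that, of p]] by (simp add: algebra_simps)
    show "continuous_on {a..b} (\<lambda>t. x t - y t)"
      using solution_continuous[OF x_sol xB v_bound1] solution_continuous[OF y_sol yB w_bound]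
      by (intro continuous_on_diff)
    show "x a - y a = 0" using init by simp
  next
    fix s p assume s: "s \<in> {a..b}"
    obtain z where z: "z \<in> B" "f (x s) $ p - f (y s) $ p = (D1 f z *v (x s - y s)) $ p"
      using convex_real_mean_value[OF convex in_B[OF s] has_derivative_component_cart[OF C2_fun_has_derivative[OF C2(1)]]]
      by blast
    have "(rhs (\<lambda>i. v i s) (x s) - rhs (\<lambda>i. w i s) (y s)) $ p - (D1 f z *v (x s - y s)) $ p
        = (\<Sum>i\<in>UNIV. v i s *\<^sub>R g i (x s)) $ p - (\<Sum>i\<in>UNIV. w i s *\<^sub>R g i (y s)) $ p"
      unfolding z(2)[symmetric] by (simp add: rhs_def)
    moreover have "\<bar>(\<Sum>i\<in>UNIV. v i s *\<^sub>R g i (x s)) $ p\<bar> \<le> 1 * K'"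
      using component_le_infnorm_cart control_part_le[OF in_B(1)[OF s], of "\<lambda>i. v i s" 1] v_bound1[OF s] order_trans by blast
    moreover have "\<bar>(\<Sum>i\<in>UNIV. w i s *\<^sub>R g i (y s)) $ p\<bar> \<le> r * K'"
      using component_le_infnorm_cart control_part_le[OF in_B(2)[OF s], of "\<lambda>i. w i s" r] w_bound[OF s] order_trans by blast
    ultimately have "\<bar>(rhs (\<lambda>i. v i s) (x s) - rhs (\<lambda>i. w i s) (y s)) $ p - (D1 f z *v (x s - y s)) $ p\<bar> \<le> (1 + r) * K'"
      unfolding distrib_right by linarith
    then show "\<exists>Q. log_infnorm Q \<le> \<Lambda> \<and> mat_infnorm Q \<le> L \<and>
        \<bar>(rhs (\<lambda>i. v i s) (x s) - rhs (\<lambda>i. w i s) (y s)) $ p - (Q *v (x s - y s)) $ p\<bar> \<le> (1 + r) * K'"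
      using f_bounds(2,3)[OF z(1)] by blast
  qed
  also have "\<dots> \<le> D" unfolding D_def
    using t r_nonneg constants_nonneg(7) by (intro mult_left_mono mult_phi_mono) auto
  finally show ?thesis .
qed

text \<open>The centred primitives of the inputs: half of the full integral is subtracted, so that the values at \<open>a\<close>
  and \<open>b\<close> are opposite.\<close>

definition Vc where "Vc i t = integral {a..t} (v i) - integral {a..b} (v i) / 2"
definition Wc where "Wc i t = integral {a..t} (w i) - integral {a..b} (w i) / 2"

lemma centred_primitive:
  fixes u :: "real \<Rightarrow> real"
  assumes "u integrable_on {a..b}" "a \<le> s" "s \<le> t" "t \<le> b"
  shows "(u has_integral ((integral {a..t} u - c) - (integral {a..s} u - c))) {s..t}"
proof -
  have "u integrable_on {s..t}" "u integrable_on {a..t}"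
    by (rule integrable_subinterval_real[OF assms(1)], use assms in auto)+
  moreover from this have "integral {s..t} u = (integral {a..t} u - c) - (integral {a..s} u - c)"
    using Henstock_Kurzweil_Integration.integral_combine[of a s t u] assms by simp
  ultimately show ?thesis using integrable_integral[of u "{s..t}"] by simp
qed

lemma Vc_int: "a \<le> s \<Longrightarrow> s \<le> t \<Longrightarrow> t \<le> b \<Longrightarrow> (v i has_integral (Vc i t - Vc i s)) {s..t}"
  unfolding Vc_def by (rule centred_primitive[OF v_int])

lemma Wc_int: "a \<le> s \<Longrightarrow> s \<le> t \<Longrightarrow> t \<le> b \<Longrightarrow> (w i has_integral (Wc i t - Wc i s)) {s..t}"
  unfolding Wc_def by (rule centred_primitive[OF w_int])

text \<open>The coincidence of the end values of \<open>Vc\<close> and \<open>Wc\<close> is the first moment condition.\<close>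

lemma centred_ends: "Vc i b = - Vc i a" "Wc i b = - Wc i a" "Vc i a = Wc i a" "Vc i b = Wc i b"
proof -
  have "integral {a..b} (v i) = integral {a..b} (w i)"
    using moment0[of i] by (simp add: Henstock_Kurzweil_Integration.integral_diff v_int w_int)
  then show "Vc i b = - Vc i a" "Wc i b = - Wc i a" "Vc i a = Wc i a" "Vc i b = Wc i b"
    by (simp_all add: Vc_def Wc_def)
qed

lemma Vc_lip: "s \<in> {a..b} \<Longrightarrow> t \<in> {a..b} \<Longrightarrow> \<bar>Vc i t - Vc i s\<bar> \<le> V i * \<bar>t - s\<bar>"
  by (rule indefinite_integral_lipschitz[where a = a and b = b, OF Vc_int v_bound])

lemma Wc_lip: "s \<in> {a..b} \<Longrightarrow> t \<in> {a..b} \<Longrightarrow> \<bar>Wc i t - Wc i s\<bar> \<le> (r * V i) * \<bar>t - s\<bar>"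
  by (rule indefinite_integral_lipschitz[where a = a and b = b, OF Wc_int w_bound])

lemma Vc_le: "t \<in> {a..b} \<Longrightarrow> \<bar>Vc i t\<bar> \<le> V i * (h / 2)"
  by (rule antiperiodic_lipschitz_abs_le[OF Vc_lip centred_ends(1)])

lemma Wc_le: "t \<in> {a..b} \<Longrightarrow> \<bar>Wc i t\<bar> \<le> r * V i * (h / 2)"
  by (rule antiperiodic_lipschitz_abs_le[OF Wc_lip centred_ends(2)])

lemma Vc_cont: "continuous_on {a..b} (Vc i)"
  unfolding Vc_def[abs_def] by (intro continuous_intros indefinite_integral_continuous_1 v_int)

lemma Wc_cont: "continuous_on {a..b} (Wc i)"
  unfolding Wc_def[abs_def] by (intro continuous_intros indefinite_integral_continuous_1 w_int)

lemma Vc_integral_le: "integral {a..b} (\<lambda>t. \<bar>Vc i t\<bar>) \<le> V i * h\<^sup>2 / 4"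
  using ab by (intro antiperiodic_lipschitz_integral_abs_le Vc_lip centred_ends Vc_cont) auto

lemma Wc_integral_le: "integral {a..b} (\<lambda>t. \<bar>Wc i t\<bar>) \<le> r * V i * h\<^sup>2 / 4"
  using ab by (intro antiperiodic_lipschitz_integral_abs_le Wc_lip centred_ends Wc_cont) auto

text \<open>The weight \<open>t - mid\<close> is itself the centred primitive of the constant \<open>1\<close>.\<close>

lemma mid_integral_le: "integral {a..b} (\<lambda>t. \<bar>t - mid\<bar>) \<le> h\<^sup>2 / 4"
proof -
  have "integral {a..b} (\<lambda>t. \<bar>t - mid\<bar>) \<le> 1 * h\<^sup>2 / 4"
  proof (rule antiperiodic_lipschitz_integral_abs_le)
    show "b - mid = - (a - mid)" by (simp add: field_simps)
  qed (use ab in \<open>auto intro!: continuous_intros\<close>)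
  then show ?thesis by simp
qed

lemma linear_weight_int: "s \<le> t \<Longrightarrow> ((\<lambda>_. 1) has_integral ((t - mid) - (s - mid))) {s..t}"
  using has_integral_const_real[of "1::real" s t] by simp

text \<open>Integrating \<open>(t - mid) (v - w)\<close> by parts, the boundary terms vanish by the first moment condition, so the
  second moment condition says as much about \<open>Vc - Wc\<close> as about the weighted difference.\<close>

lemma primitive_difference_has_integral_0:
  "((\<lambda>t. Vc i t - Wc i t) has_integral 0) {a..b}"
  and weighted_difference_has_integral_0:
  "((\<lambda>t. (t - mid) * (v i t - w i t)) has_integral 0) {a..b}"
proof -
  have W: "((\<lambda>t. v i t - w i t) has_integral ((Vc i t - Wc i t) - (Vc i s - Wc i s))) {s..t}"
    if "a \<le> s" "s \<le> t" "t \<le> b" for s t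
    using has_integral_diff[OF Vc_int[OF that] Wc_int[OF that]] by (simp add: algebra_simps)
  have bd: "\<bar>v i t - w i t\<bar> \<le> V i + r * V i" if "t \<in> {a..b}" for t
    using v_bound[OF that, of i] w_bound[OF that, of i] by linarith
  have parts: "((\<lambda>t. 1 * (Vc i t - Wc i t) + (t - mid) * (v i t - w i t)) has_integral
      ((b - mid) * (Vc i b - Wc i b) - (a - mid) * (Vc i a - Wc i a))) {a..b}"
    by (rule integration_by_parts_indefinite[where Mu = 1, OF less_imp_le[OF ab] linear_weight_int W _ bd]) auto
  then have parts: "((\<lambda>t. (Vc i t - Wc i t) + (t - mid) * (v i t - w i t)) has_integral 0) {a..b}"
    by (simp add: centred_ends)
  have "(\<lambda>t. Vc i t - Wc i t) integrable_on {a..b}"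
    by (intro integrable_continuous_interval continuous_on_diff Vc_cont Wc_cont)
  then have I: "((\<lambda>t. Vc i t - Wc i t) has_integral (integral {a..b} (\<lambda>t. Vc i t - Wc i t))) {a..b}"
    by (rule integrable_integral)
  have J: "((\<lambda>t. (t - mid) * (v i t - w i t)) has_integral (0 - integral {a..b} (\<lambda>t. Vc i t - Wc i t))) {a..b}"
    using has_integral_diff[OF parts I] by simp
  then have z: "integral {a..b} (\<lambda>t. Vc i t - Wc i t) = 0"
    using integral_unique[OF J] moment1[of i] by linarith
  show "((\<lambda>t. Vc i t - Wc i t) has_integral 0) {a..b}" using I z by simp
  show "((\<lambda>t. (t - mid) * (v i t - w i t)) has_integral 0) {a..b}" using J z by simp
qed

definition velocity_x where "velocity_x t = rhs (\<lambda>i. v i t) (x t)"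
definition velocity_y where "velocity_y t = rhs (\<lambda>i. w i t) (y t)"

lemma matrix_rhs:
  "(Q *v rhs c z) $ p = (Q *v f z) $ p + (\<Sum>i\<in>UNIV. c i * (Q *v g i z) $ p)"
  by (simp add: rhs_def matrix_vector_right_distrib linear_sum[OF matrix_vector_mul_linear]
      matrix_vector_mult_scaleR)

lemma trajectory_near_mid:
  assumes t: "t \<in> {a..b}"
  shows "infnorm (x t - x mid) \<le> (K + K') * \<bar>t - mid\<bar>"
  using solution_lipschitz[OF x_sol xB v_bound1, of mid t] t ab by simp

text \<open>The difference of the two derivatives of \<open>f\<close> is split three ways: drift at \<open>x\<close> against drift at \<open>y\<close>, the
  control fields at \<open>x\<close> and \<open>y\<close> with the common input \<open>w\<close>, and the input difference \<open>v - w\<close> multiplied by a field at \<open>x\<close>.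
  In the last part the field at \<open>x mid\<close> has been subtracted.\<close>

lemma f_weighted_term_le:
  fixes p
  assumes t: "t \<in> {a..b}"
  shows "\<bar>(t - mid) * ((D1 f (x t) *v velocity_x t) $ p - (D1 f (y t) *v velocity_y t) $ p)
      - (\<Sum>i\<in>UNIV. (D1 f (x mid) *v g i (x mid)) $ p * ((t - mid) * (v i t - w i t)))\<bar>
    \<le> \<bar>t - mid\<bar> * ((H * K + L\<^sup>2) * D + r * (H * K' + L * L') * D
        + (1 + r) * (H * K' + L * L') * ((K + K') * (h / 2)))"
proof -
  have mid: "mid \<in> {a..b}" using ab by auto
  define q0 where "q0 = (D1 f (x t) *v f (x t)) $ p - (D1 f (y t) *v f (y t)) $ p"
  define q1 where "q1 i = (D1 f (x t) *v g i (x t)) $ p - (D1 f (y t) *v g i (y t)) $ p" for i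
  define q2 where "q2 i = (D1 f (x t) *v g i (x t)) $ p - (D1 f (x mid) *v g i (x mid)) $ p" for i
  have HK: "H * Kg i + L * Lg i \<ge> 0" for i using constants_nonneg by simp
  have "\<bar>q0\<bar> \<le> (H * K + L * L) * infnorm (x t - y t)"
    unfolding q0_def by (rule directional_Lipschitz(1)[OF in_B[OF t]])
  also have "\<dots> \<le> (H * K + L\<^sup>2) * D"
    using trajectories_close[OF t] constants_nonneg by (simp add: power2_eq_square mult_left_mono)
  finally have b0: "\<bar>q0\<bar> \<le> (H * K + L\<^sup>2) * D" .
  have b1: "\<bar>w i t * q1 i\<bar> \<le> (r * V i) * ((H * Kg i + L * Lg i) * D)" for i
  proof -
    have "\<bar>q1 i\<bar> \<le> (H * Kg i + L * Lg i) * infnorm (x t - y t)"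
      unfolding q1_def by (rule directional_Lipschitz(2)[OF in_B[OF t]])
    also have "\<dots> \<le> (H * Kg i + L * Lg i) * D"
      using trajectories_close[OF t] HK by (intro mult_left_mono) auto
    finally show ?thesis unfolding abs_mult using w_bound[OF t, of i] r_nonneg V_nonneg[of i]
      by (intro mult_mono) auto
  qed
  have b2: "\<bar>(v i t - w i t) * q2 i\<bar> \<le> ((1 + r) * V i) * ((H * Kg i + L * Lg i) * ((K + K') * (h / 2)))" for i
  proof -
    have "\<bar>q2 i\<bar> \<le> (H * Kg i + L * Lg i) * infnorm (x t - x mid)"
      unfolding q2_def by (rule directional_Lipschitz(2)[OF in_B(1)[OF t] in_B(1)[OF mid]])
    also have "\<dots> \<le> (H * Kg i + L * Lg i) * ((K + K') * (h / 2))"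
    proof (intro mult_left_mono HK)
      have "\<bar>t - mid\<bar> \<le> h / 2" unfolding abs_le_iff using t by (simp add: field_simps)
      then have "(K + K') * \<bar>t - mid\<bar> \<le> (K + K') * (h / 2)"
        using constants_nonneg by (intro mult_left_mono) auto
      then show "infnorm (x t - x mid) \<le> (K + K') * (h / 2)" using trajectory_near_mid[OF t] by linarith
    qed
    finally show ?thesis unfolding abs_mult using v_bound[OF t, of i] w_bound[OF t, of i] r_nonneg V_nonneg[of i]
      by (intro mult_mono) (auto simp: algebra_simps)
  qed
  have S1: "(\<Sum>i\<in>UNIV. (r * V i) * ((H * Kg i + L * Lg i) * D)) = r * (H * K' + L * L') * D"
    unfolding K'_def L'_def sum_distrib_left sum_distrib_right sum.distrib[symmetric]
    by (intro sum.cong) (auto simp: algebra_simps)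
  have S2: "(\<Sum>i\<in>UNIV. ((1 + r) * V i) * ((H * Kg i + L * Lg i) * C)) = (1 + r) * (H * K' + L * L') * C" for C
    unfolding K'_def L'_def sum_distrib_left sum_distrib_right sum.distrib[symmetric]
    by (intro sum.cong) (auto simp: algebra_simps)
  have eq: "(t - mid) * ((D1 f (x t) *v velocity_x t) $ p - (D1 f (y t) *v velocity_y t) $ p)
      - (\<Sum>i\<in>UNIV. (D1 f (x mid) *v g i (x mid)) $ p * ((t - mid) * (v i t - w i t)))
    = (t - mid) * (q0 + ((\<Sum>i\<in>UNIV. w i t * q1 i) + (\<Sum>i\<in>UNIV. (v i t - w i t) * q2 i)))"
  proof -
    have "d * ((\<phi> + (\<Sum>i\<in>UNIV. v i t * G i)) - (\<phi>' + (\<Sum>i\<in>UNIV. w i t * G' i)))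
        - (\<Sum>i\<in>UNIV. P i * (d * (v i t - w i t)))
      = d * ((\<phi> - \<phi>') + ((\<Sum>i\<in>UNIV. w i t * (G i - G' i)) + (\<Sum>i\<in>UNIV. (v i t - w i t) * (G i - P i))))"
      for d \<phi> \<phi>' :: real and G G' P
      by (simp add: algebra_simps sum.distrib sum_subtractf sum_distrib_left)
    then show ?thesis unfolding velocity_x_def velocity_y_def matrix_rhs q0_def q1_def q2_def .
  qed
  have "\<bar>(t - mid) * (q0 + ((\<Sum>i\<in>UNIV. w i t * q1 i) + (\<Sum>i\<in>UNIV. (v i t - w i t) * q2 i)))\<bar>
    \<le> \<bar>t - mid\<bar> * ((H * K + L\<^sup>2) * D + ((\<Sum>i\<in>UNIV. (r * V i) * ((H * Kg i + L * Lg i) * D))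
      + (\<Sum>i\<in>UNIV. ((1 + r) * V i) * ((H * Kg i + L * Lg i) * ((K + K') * (h / 2))))))"
    unfolding abs_mult
  proof (intro mult_left_mono abs_ge_zero)
    have "\<bar>\<Sum>i\<in>UNIV. w i t * q1 i\<bar> \<le> (\<Sum>i\<in>UNIV. (r * V i) * ((H * Kg i + L * Lg i) * D))"
      using b1 by (intro order_trans[OF sum_abs] sum_mono) auto
    moreover have "\<bar>\<Sum>i\<in>UNIV. (v i t - w i t) * q2 i\<bar>
        \<le> (\<Sum>i\<in>UNIV. ((1 + r) * V i) * ((H * Kg i + L * Lg i) * ((K + K') * (h / 2))))"
      using b2 by (intro order_trans[OF sum_abs] sum_mono) auto
    ultimately show "\<bar>q0 + ((\<Sum>i\<in>UNIV. w i t * q1 i) + (\<Sum>i\<in>UNIV. (v i t - w i t) * q2 i))\<bar>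
      \<le> (H * K + L\<^sup>2) * D + ((\<Sum>i\<in>UNIV. (r * V i) * ((H * Kg i + L * Lg i) * D))
      + (\<Sum>i\<in>UNIV. ((1 + r) * V i) * ((H * Kg i + L * Lg i) * ((K + K') * (h / 2)))))"
      using b0 by linarith
  qed
  then show ?thesis unfolding eq S1 S2 by (simp only: add.assoc)
qed

text \<open>Only the part along \<open>f\<close> is differenced, with coefficient \<open>Vc - Wc\<close> between \<open>x t\<close> and \<open>x mid\<close>, and with
  coefficient \<open>Wc\<close> between \<open>x t\<close> and \<open>y t\<close>.  The parts along the control fields are bounded without any cancellation,
  since centring already gives them the constant required at second order.\<close>

lemma g_weighted_term_le:
  fixes p i
  assumes t: "t \<in> {a..b}"
  shows "\<bar>Vc i t * (D1 (g i) (x t) *v velocity_x t) $ p - Wc i t * (D1 (g i) (y t) *v velocity_y t) $ p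
      - (D1 (g i) (x mid) *v f (x mid)) $ p * (Vc i t - Wc i t)\<bar>
    \<le> (1 + r) * V i * (h / 2) * ((Hg i * K + Lg i * L) * (K + K')) * \<bar>t - mid\<bar>
      + Lg i * K' * \<bar>Vc i t\<bar> + (Lg i * (r * K') + (Hg i * K + Lg i * L) * D) * \<bar>Wc i t\<bar>"
proof -
  have mid: "mid \<in> {a..b}" using ab by auto
  define q1 where "q1 = (D1 (g i) (x t) *v f (x t)) $ p - (D1 (g i) (x mid) *v f (x mid)) $ p"
  define q2 where "q2 = (D1 (g i) (x t) *v f (x t)) $ p - (D1 (g i) (y t) *v f (y t)) $ p"
  define q3 where "q3 = (D1 (g i) (x t) *v (\<Sum>j\<in>UNIV. v j t *\<^sub>R g j (x t))) $ p"
  define q4 where "q4 = (D1 (g i) (y t) *v (\<Sum>j\<in>UNIV. w j t *\<^sub>R g j (y t))) $ p"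
  have HK: "Hg i * K + Lg i * L \<ge> 0" using constants_nonneg by simp
  have "\<bar>q1\<bar> \<le> (Hg i * K + Lg i * L) * infnorm (x t - x mid)"
    unfolding q1_def by (rule directional_Lipschitz(3)[OF in_B(1)[OF t] in_B(1)[OF mid]])
  also have "\<dots> \<le> (Hg i * K + Lg i * L) * ((K + K') * \<bar>t - mid\<bar>)"
    by (intro mult_left_mono HK trajectory_near_mid t)
  finally have b1: "\<bar>q1\<bar> \<le> (Hg i * K + Lg i * L) * ((K + K') * \<bar>t - mid\<bar>)" .
  have "\<bar>q2\<bar> \<le> (Hg i * K + Lg i * L) * infnorm (x t - y t)"
    unfolding q2_def by (rule directional_Lipschitz(3)[OF in_B[OF t]])
  also have "\<dots> \<le> (Hg i * K + Lg i * L) * D" by (intro mult_left_mono HK trajectories_close t)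
  finally have b2: "\<bar>q2\<bar> \<le> (Hg i * K + Lg i * L) * D" .
  have b3: "\<bar>q3\<bar> \<le> Lg i * (1 * K')" unfolding q3_def
    by (intro component_matrix_vector_le g_bounds control_part_le in_B t v_bound1)
  have b4: "\<bar>q4\<bar> \<le> Lg i * (r * K')" unfolding q4_def
    by (intro component_matrix_vector_le g_bounds control_part_le in_B t w_bound)
  have d: "\<bar>Vc i t - Wc i t\<bar> \<le> (1 + r) * V i * (h / 2)"
    using Vc_le[OF t, of i] Wc_le[OF t, of i] unfolding distrib_right mult_1 by linarith
  have eq: "Vc i t * (D1 (g i) (x t) *v velocity_x t) $ p - Wc i t * (D1 (g i) (y t) *v velocity_y t) $ p
      - (D1 (g i) (x mid) *v f (x mid)) $ p * (Vc i t - Wc i t)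
    = (Vc i t - Wc i t) * q1 + Wc i t * q2 + Vc i t * q3 - Wc i t * q4"
    unfolding velocity_x_def velocity_y_def rhs_def q1_def q2_def q3_def q4_def
    by (simp only: matrix_vector_right_distrib vector_add_component) (simp add: algebra_simps)
  have "\<bar>(Vc i t - Wc i t) * q1 + Wc i t * q2 + Vc i t * q3 - Wc i t * q4\<bar>
      \<le> \<bar>Vc i t - Wc i t\<bar> * \<bar>q1\<bar> + \<bar>Wc i t\<bar> * \<bar>q2\<bar> + \<bar>Vc i t\<bar> * \<bar>q3\<bar> + \<bar>Wc i t\<bar> * \<bar>q4\<bar>"
    unfolding abs_mult[symmetric] by linarith
  also have "\<dots> \<le> ((1 + r) * V i * (h / 2)) * ((Hg i * K + Lg i * L) * ((K + K') * \<bar>t - mid\<bar>))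
      + \<bar>Wc i t\<bar> * ((Hg i * K + Lg i * L) * D) + \<bar>Vc i t\<bar> * (Lg i * (1 * K')) + \<bar>Wc i t\<bar> * (Lg i * (r * K'))"
    using r_nonneg V_nonneg[of i] ab by (intro add_mono mult_mono d b1 mult_left_mono b2 b3 b4) auto
  also have "\<dots> = (1 + r) * V i * (h / 2) * ((Hg i * K + Lg i * L) * (K + K')) * \<bar>t - mid\<bar>
      + Lg i * K' * \<bar>Vc i t\<bar> + (Lg i * (r * K') + (Hg i * K + Lg i * L) * D) * \<bar>Wc i t\<bar>"
  proof -
    have "c * (A * (S * T)) + W * (A * D) + U * (l * (1 * K')) + W * (l * (r * K'))
        = c * (A * S) * T + l * K' * U + (l * (r * K') + A * D) * W" for c A S T U W l :: real
      by (simp add: algebra_simps)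
    then show ?thesis .
  qed
  finally show ?thesis unfolding eq .
qed

lemma component_difference_le:
  assumes "C2_fun F" "\<And>z. z \<in> B \<Longrightarrow> mat_infnorm (D1 F z) \<le> M"
  shows "\<bar>F (x b) $ p - F (y b) $ p\<bar> \<le> M * infnorm (x b - y b)"
  using ab by (intro C2_component_lipschitz[OF convex in_B assms]) auto

lemma component_derivative_bounded:
  assumes t: "t \<in> {a..b}" and F: "\<And>z. z \<in> B \<Longrightarrow> mat_infnorm (D1 F z) \<le> M"
  shows "\<bar>(D1 F (x t) *v velocity_x t) $ p\<bar> \<le> M * (K + 1 * K')" "\<bar>(D1 F (y t) *v velocity_y t) $ p\<bar> \<le> M * (K + r * K')"
  unfolding velocity_x_def velocity_y_def
  by (intro component_matrix_vector_le F rhs_le in_B t v_bound1 w_bound)+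

lemma f_by_parts:
  "((\<lambda>t. (f (x t) $ p - f (y t) $ p) + (t - mid) * ((D1 f (x t) *v velocity_x t) $ p - (D1 f (y t) *v velocity_y t) $ p))
     has_integral (h / 2 * (f (x b) $ p - f (y b) $ p))) {a..b}"
proof -
  let ?M = "L * (K + 1 * K') + L * (K + r * K')"
  have W: "((\<lambda>t. (D1 f (x t) *v velocity_x t) $ p - (D1 f (y t) *v velocity_y t) $ p) has_integral
      ((f (x t) $ p - f (y t) $ p) - (f (x s) $ p - f (y s) $ p))) {s..t}"
    if "a \<le> s" "s \<le> t" "t \<le> b" for s t
    using has_integral_diff[OF component_chain_rule[OF x_sol xB C2(1) f_bounds(3) that, of p]
        component_chain_rule[OF y_sol yB C2(1) f_bounds(3) that, of p]]
    unfolding velocity_x_def velocity_y_def by (simp add: algebra_simps)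
  have bd: "\<bar>(D1 f (x t) *v velocity_x t) $ p - (D1 f (y t) *v velocity_y t) $ p\<bar> \<le> ?M" if "t \<in> {a..b}" for t
    using component_derivative_bounded[OF that f_bounds(3), where p = p] by linarith
  have "((\<lambda>t. 1 * (f (x t) $ p - f (y t) $ p) + (t - mid) * ((D1 f (x t) *v velocity_x t) $ p - (D1 f (y t) *v velocity_y t) $ p))
     has_integral ((b - mid) * (f (x b) $ p - f (y b) $ p) - (a - mid) * (f (x a) $ p - f (y a) $ p))) {a..b}"
    by (rule integration_by_parts_indefinite[where Mu = 1, OF less_imp_le[OF ab] linear_weight_int W _ bd]) auto
  moreover have "b - mid = h / 2" by (simp add: field_simps)
  ultimately show ?thesis by (simp add: init)
qed

text \<open>The contributions at \<open>a\<close> cancel because the trajectories start together and \<open>Vc a = Wc a\<close>.\<close>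

lemma g_by_parts:
  "((\<lambda>t. (v i t * g i (x t) $ p - w i t * g i (y t) $ p)
      + (Vc i t * (D1 (g i) (x t) *v velocity_x t) $ p - Wc i t * (D1 (g i) (y t) *v velocity_y t) $ p))
     has_integral (Vc i b * (g i (x b) $ p - g i (y b) $ p))) {a..b}"
proof -
  have 1: "((\<lambda>t. v i t * g i (x t) $ p + Vc i t * (D1 (g i) (x t) *v velocity_x t) $ p) has_integral
      (Vc i b * g i (x b) $ p - Vc i a * g i (x a) $ p)) {a..b}"
  proof (rule integration_by_parts_indefinite[OF less_imp_le[OF ab] Vc_int _ v_bound component_derivative_bounded(1)[OF _ g_bounds(2)]])
    show "((\<lambda>t. (D1 (g i) (x t) *v velocity_x t) $ p) has_integral (g i (x t) $ p - g i (x s) $ p)) {s..t}"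
      if "a \<le> s" "s \<le> t" "t \<le> b" for s t
      unfolding velocity_x_def by (rule component_chain_rule[OF x_sol xB C2(2) g_bounds(2) that])
  qed
  have 2: "((\<lambda>t. w i t * g i (y t) $ p + Wc i t * (D1 (g i) (y t) *v velocity_y t) $ p) has_integral
      (Wc i b * g i (y b) $ p - Wc i a * g i (y a) $ p)) {a..b}"
  proof (rule integration_by_parts_indefinite[OF less_imp_le[OF ab] Wc_int _ w_bound component_derivative_bounded(2)[OF _ g_bounds(2)]])
    show "((\<lambda>t. (D1 (g i) (y t) *v velocity_y t) $ p) has_integral (g i (y t) $ p - g i (y s) $ p)) {s..t}"
      if "a \<le> s" "s \<le> t" "t \<le> b" for s t
      unfolding velocity_y_def by (rule component_chain_rule[OF y_sol yB C2(2) g_bounds(2) that])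
  qed
  have e: "Vc i b * g i (x b) $ p - Vc i a * g i (x a) $ p - (Wc i b * g i (y b) $ p - Wc i a * g i (y a) $ p)
      = Vc i b * (g i (x b) $ p - g i (y b) $ p)"
    using centred_ends(3,4)[of i] init by (simp add: algebra_simps)
  show ?thesis using has_integral_diff[OF 1 2] unfolding e by (simp add: algebra_simps)
qed

text \<open>The coefficient of \<open>\<bar>t - mid\<bar>\<close> in the pointwise bound of the integrand that is left after integration by
  parts.\<close>

definition majorant_mid :: real where
  "majorant_mid = (H * K + L\<^sup>2) * D + r * (H * K' + L * L') * D
     + (1 + r) * (H * K' + L * L') * ((K + K') * (h / 2))
     + (1 + r) * (h / 2) * ((H' * K + L' * L) * (K + K'))"

lemma component_error_le:
  "\<bar>(x b - y b) $ p\<bar> \<le> (L * (h / 2) + r * L' * (h / 2)) * infnorm (x b - y b)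
     + (majorant_mid + L' * K' + r * (L' * (r * K') + (H' * K + L' * L) * D)) * (h\<^sup>2 / 4)"
proof -
  define Zf where "Zf t = (t - mid) * ((D1 f (x t) *v velocity_x t) $ p - (D1 f (y t) *v velocity_y t) $ p)" for t
  define Zg where "Zg i t = Vc i t * (D1 (g i) (x t) *v velocity_x t) $ p - Wc i t * (D1 (g i) (y t) *v velocity_y t) $ p" for i t
  define P where "P i = (D1 f (x mid) *v g i (x mid)) $ p" for i
  define R where "R i = (D1 (g i) (x mid) *v f (x mid)) $ p" for i
  define bdry where "bdry = h / 2 * (f (x b) $ p - f (y b) $ p) + (\<Sum>i\<in>UNIV. Vc i b * (g i (x b) $ p - g i (y b) $ p))"
  have err: "((\<lambda>t. (f (x t) $ p - f (y t) $ p) + (\<Sum>i\<in>UNIV. v i t * g i (x t) $ p - w i t * g i (y t) $ p))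
      has_integral (x b - y b) $ p) {a..b}"
    using has_integral_diff[OF solution_component_integral[OF x_sol xB order_refl less_imp_le[OF ab] order_refl, of p]
        solution_component_integral[OF y_sol yB order_refl less_imp_le[OF ab] order_refl, of p]]
    by (simp add: rhs_def init sum_subtractf algebra_simps)
  have parts: "((\<lambda>t. ((f (x t) $ p - f (y t) $ p) + Zf t)
      + (\<Sum>i\<in>UNIV. (v i t * g i (x t) $ p - w i t * g i (y t) $ p) + Zg i t)) has_integral bdry) {a..b}"
    unfolding bdry_def Zf_def Zg_def by (intro has_integral_add has_integral_sum f_by_parts g_by_parts) auto
  have Z: "((\<lambda>t. Zf t + (\<Sum>i\<in>UNIV. Zg i t)) has_integral (bdry - (x b - y b) $ p)) {a..b}"
  proof -
    have "(\<lambda>t. (((f (x t) $ p - f (y t) $ p) + Zf t)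
        + (\<Sum>i\<in>UNIV. (v i t * g i (x t) $ p - w i t * g i (y t) $ p) + Zg i t))
        - ((f (x t) $ p - f (y t) $ p) + (\<Sum>i\<in>UNIV. v i t * g i (x t) $ p - w i t * g i (y t) $ p)))
      = (\<lambda>t. Zf t + (\<Sum>i\<in>UNIV. Zg i t))"
      by (intro ext) (simp add: sum.distrib)
    then show ?thesis using has_integral_diff[OF parts err] by simp
  qed
  have N: "((\<lambda>t. (\<Sum>i\<in>UNIV. P i * ((t - mid) * (v i t - w i t))) + (\<Sum>i\<in>UNIV. R i * (Vc i t - Wc i t)))
      has_integral ((\<Sum>i\<in>UNIV. P i * 0) + (\<Sum>i\<in>UNIV. R i * 0))) {a..b}"
    by (intro has_integral_add has_integral_sum has_integral_mult_right
        primitive_difference_has_integral_0 weighted_difference_has_integral_0) auto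
  \<comment> \<open>What is left under the integral once functions with integral zero have been subtracted.\<close>
  define rest where "rest t = (Zf t - (\<Sum>i\<in>UNIV. P i * ((t - mid) * (v i t - w i t))))
      + (\<Sum>i\<in>UNIV. Zg i t - R i * (Vc i t - Wc i t))" for t
  have rest: "(rest has_integral (bdry - (x b - y b) $ p)) {a..b}"
  proof -
    have "(\<lambda>t. (Zf t + (\<Sum>i\<in>UNIV. Zg i t)) - ((\<Sum>i\<in>UNIV. P i * ((t - mid) * (v i t - w i t)))
        + (\<Sum>i\<in>UNIV. R i * (Vc i t - Wc i t)))) = rest"
      by (intro ext) (unfold rest_def sum_subtractf, linarith)
    then show ?thesis using has_integral_diff[OF Z N] by simp
  qed
  define cV where "cV i = Lg i * K'" for i
  define cW where "cW i = Lg i * (r * K') + (Hg i * K + Lg i * L) * D" for i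
  define maj where "maj t = majorant_mid * \<bar>t - mid\<bar> + (\<Sum>i\<in>UNIV. cV i * \<bar>Vc i t\<bar>) + (\<Sum>i\<in>UNIV. cW i * \<bar>Wc i t\<bar>)" for t
  have rest_le: "\<bar>rest t\<bar> \<le> maj t" if t: "t \<in> {a..b}" for t
  proof -
    have "\<bar>rest t\<bar> \<le> \<bar>Zf t - (\<Sum>i\<in>UNIV. P i * ((t - mid) * (v i t - w i t)))\<bar>
        + (\<Sum>i\<in>UNIV. \<bar>Zg i t - R i * (Vc i t - Wc i t)\<bar>)"
      unfolding rest_def by (rule order_trans[OF abs_triangle_ineq add_left_mono[OF sum_abs]])
    also have "\<dots> \<le> \<bar>t - mid\<bar> * ((H * K + L\<^sup>2) * D + r * (H * K' + L * L') * D
        + (1 + r) * (H * K' + L * L') * ((K + K') * (h / 2)))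
      + (\<Sum>i\<in>UNIV. (1 + r) * V i * (h / 2) * ((Hg i * K + Lg i * L) * (K + K')) * \<bar>t - mid\<bar>
          + cV i * \<bar>Vc i t\<bar> + cW i * \<bar>Wc i t\<bar>)"
      unfolding Zf_def Zg_def P_def R_def cV_def cW_def
      by (intro add_mono sum_mono f_weighted_term_le g_weighted_term_le t)
    also have "\<dots> = maj t"
    proof -
      have "(\<Sum>i\<in>UNIV. (1 + r) * V i * c * ((Hg i * K + Lg i * L) * A) * \<tau>)
          = (1 + r) * c * ((H' * K + L' * L) * A) * \<tau>" for c A \<tau> :: real
        unfolding H'_def L'_def sum_distrib_left sum_distrib_right sum.distrib[symmetric]
        by (intro sum.cong) (auto simp: algebra_simps)
      note S = this
      have "\<tau> * A + (Q * \<tau> + S1 + S2) = (A + Q) * \<tau> + S1 + S2" for \<tau> A Q S1 S2 :: real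
        by (simp add: algebra_simps)
      then show ?thesis unfolding maj_def majorant_mid_def sum.distrib S .
    qed
    finally show ?thesis .
  qed
  have int: "(\<lambda>t. \<bar>t - mid\<bar>) integrable_on {a..b}" "(\<lambda>t. \<bar>Vc i t\<bar>) integrable_on {a..b}"
    "(\<lambda>t. \<bar>Wc i t\<bar>) integrable_on {a..b}" for i
    by (intro integrable_continuous_interval continuous_intros Vc_cont Wc_cont)+
  have maj_int: "(maj has_integral (majorant_mid * integral {a..b} (\<lambda>t. \<bar>t - mid\<bar>)
      + (\<Sum>i\<in>UNIV. cV i * integral {a..b} (\<lambda>t. \<bar>Vc i t\<bar>)) + (\<Sum>i\<in>UNIV. cW i * integral {a..b} (\<lambda>t. \<bar>Wc i t\<bar>)))) {a..b}"
    unfolding maj_def[abs_def]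
    by (intro has_integral_add has_integral_sum has_integral_mult_right integrable_integral int) auto
  have nn: "majorant_mid \<ge> 0" "cV i \<ge> 0" "cW i \<ge> 0" for i
    unfolding majorant_mid_def cV_def cW_def using constants_nonneg D_nonneg r_nonneg ab by auto
  have S1: "(\<Sum>i\<in>UNIV. cV i * (V i * h\<^sup>2 / 4)) = L' * K' * (h\<^sup>2 / 4)"
    unfolding L'_def cV_def sum_distrib_right by (intro sum.cong) auto
  have S2: "(\<Sum>i\<in>UNIV. cW i * (r * V i * h\<^sup>2 / 4)) = r * (L' * (r * K') + (H' * K + L' * L) * D) * (h\<^sup>2 / 4)"
    unfolding L'_def H'_def cW_def sum_distrib_left sum_distrib_right sum.distrib[symmetric]
    by (intro sum.cong) (auto simp: algebra_simps)
  have "\<bar>bdry - (x b - y b) $ p\<bar> = norm (integral {a..b} rest)" using integral_unique[OF rest] by simp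
  also have "\<dots> \<le> integral {a..b} maj"
    using rest_le rest maj_int by (intro integral_norm_bound_integral) (auto intro: has_integral_integrable)
  also have "\<dots> = majorant_mid * integral {a..b} (\<lambda>t. \<bar>t - mid\<bar>)
      + (\<Sum>i\<in>UNIV. cV i * integral {a..b} (\<lambda>t. \<bar>Vc i t\<bar>)) + (\<Sum>i\<in>UNIV. cW i * integral {a..b} (\<lambda>t. \<bar>Wc i t\<bar>))"
    using integral_unique[OF maj_int] .
  also have "\<dots> \<le> majorant_mid * (h\<^sup>2 / 4) + (\<Sum>i\<in>UNIV. cV i * (V i * h\<^sup>2 / 4)) + (\<Sum>i\<in>UNIV. cW i * (r * V i * h\<^sup>2 / 4))"
    by (intro add_mono sum_mono mult_left_mono mid_integral_le Vc_integral_le Wc_integral_le nn)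
  finally have main: "\<bar>bdry - (x b - y b) $ p\<bar> \<le> majorant_mid * (h\<^sup>2 / 4) + L' * K' * (h\<^sup>2 / 4)
      + r * (L' * (r * K') + (H' * K + L' * L) * D) * (h\<^sup>2 / 4)" unfolding S1 S2 .
  have "\<bar>bdry\<bar> \<le> (h / 2) * (L * infnorm (x b - y b)) + (\<Sum>i\<in>UNIV. (r * V i * (h / 2)) * (Lg i * infnorm (x b - y b)))"
  proof -
    have "\<bar>h / 2 * (f (x b) $ p - f (y b) $ p)\<bar> \<le> (h / 2) * (L * infnorm (x b - y b))"
      using ab component_difference_le[OF C2(1) f_bounds(3), of p] by (simp add: abs_mult)
    moreover have "\<bar>\<Sum>i\<in>UNIV. Vc i b * (g i (x b) $ p - g i (y b) $ p)\<bar>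
        \<le> (\<Sum>i\<in>UNIV. (r * V i * (h / 2)) * (Lg i * infnorm (x b - y b)))"
    proof (rule order_trans[OF sum_abs sum_mono])
      fix i
      have "\<bar>Vc i b\<bar> \<le> r * V i * (h / 2)" unfolding centred_ends(4) using ab by (intro Wc_le) auto
      then show "\<bar>Vc i b * (g i (x b) $ p - g i (y b) $ p)\<bar> \<le> (r * V i * (h / 2)) * (Lg i * infnorm (x b - y b))"
        unfolding abs_mult using component_difference_le[OF C2(2) g_bounds(2), of i p] r_nonneg V_nonneg[of i] ab
        by (intro mult_mono) auto
    qed
    ultimately show ?thesis unfolding bdry_def by linarith
  qed
  also have "\<dots> = (L * (h / 2) + r * L' * (h / 2)) * infnorm (x b - y b)"
    unfolding L'_def by (simp add: sum_distrib_left sum_distrib_right algebra_simps)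
  finally show ?thesis using main unfolding distrib_right[of _ _ "h\<^sup>2 / 4"] by linarith
qed

text \<open>Inserting \<open>D\<close> and collecting powers of \<open>h\<close>.  The boundary term of the controls enters with half
  of the coefficient stated, and the coefficients of \<open>phi\<close> and of \<open>H' K + L L'\<close> are also at most the stated ones; the
  second order term and the coefficient of \<open>H K' + L L'\<close> are exactly those stated.\<close>

lemma local_error_le:
  "(1 - L * (h / 2) - h * r * L') * infnorm (x b - y b) \<le>
     h^2 / 4 * (1 + r^2) * L' * K'
   + h^3 / 4 * (1 + r) * K' *
       ((2 * r * H' + H) * (K + r * K') + L^2 + (3 * r * L + 2 * r^2 * L') * L') * phi (\<Lambda> * h)
   + h^3 / 24 * (1 + r) * (K + K') * (3 * (H * K' + L * L') + 4 * (H' * K + L * L'))"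
proof -
  let ?e = "infnorm (x b - y b)"
  obtain p where p: "?e = \<bar>(x b - y b) $ p\<bar>" by (rule infnorm_attained_cart)
  define \<Phi> where "\<Phi> = (1 + r) * K' * phi (\<Lambda> * h)"
  have nn: "0 \<le> \<Phi>" "0 \<le> h" "0 \<le> ?e"
    using r_nonneg constants_nonneg(7) phi_pos[of "\<Lambda> * h"] ab infnorm_pos_le by (auto simp: \<Phi>_def)
  have D: "D = \<Phi> * h" by (simp add: D_def \<Phi>_def)
  note c = constants_nonneg(1-3,7-9) r_nonneg nn
  have 1: "r * L' * (h / 2) * ?e \<le> h * r * L' * ?e"
  proof (intro mult_right_mono)
    have "(r * L') * (h / 2) \<le> (r * L') * h" using c by (intro mult_left_mono) auto
    then show "r * L' * (h / 2) \<le> h * r * L'" by (simp add: mult_ac)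
  qed (use c in auto)
  have 2: "((H * K + L\<^sup>2) + r * (H * K' + L * L') + r * (H' * K + L' * L)) * (\<Phi> * h^3 / 4)
     \<le> ((2 * r * H' + H) * (K + r * K') + L^2 + (3 * r * L + 2 * r^2 * L') * L') * (\<Phi> * h^3 / 4)"
  proof (rule mult_right_mono)
    have "(2 * r * H' + H) * (K + r * K') + L^2 + (3 * r * L + 2 * r^2 * L') * L'
       - ((H * K + L\<^sup>2) + r * (H * K' + L * L') + r * (H' * K + L' * L))
       = r * H' * K + 2 * r * H' * r * K' + r * L * L' + 2 * r^2 * L' * L'"
      by (simp add: algebra_simps)
    also have "\<dots> \<ge> 0" using c by simp
    finally show "(H * K + L\<^sup>2) + r * (H * K' + L * L') + r * (H' * K + L' * L)
      \<le> (2 * r * H' + H) * (K + r * K') + L^2 + (3 * r * L + 2 * r^2 * L') * L'" by linarith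
  qed (use c in auto)
  have 3: "(H' * K + L' * L) * ((1 + r) * (K + K') * h^3) / 8 \<le> (H' * K + L' * L) * ((1 + r) * (K + K') * h^3) / 6"
    using c by (intro divide_left_mono) auto
  have "(1 - L * (h / 2) - h * r * L') * ?e \<le> ?e - (L * (h / 2) + r * L' * (h / 2)) * ?e"
    using 1 by (simp add: algebra_simps)
  also have "\<dots> \<le> (majorant_mid + L' * K' + r * (L' * (r * K') + (H' * K + L' * L) * D)) * (h\<^sup>2 / 4)"
    using component_error_le[of p] unfolding p[symmetric] by linarith
  also have "\<dots> = h^2 / 4 * (1 + r^2) * L' * K'
      + ((H * K + L\<^sup>2) + r * (H * K' + L * L') + r * (H' * K + L' * L)) * (\<Phi> * h^3 / 4)
      + (H * K' + L * L') * ((1 + r) * (K + K') * h^3) / 8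
      + (H' * K + L' * L) * ((1 + r) * (K + K') * h^3) / 8"
    unfolding majorant_mid_def D by (simp add: field_simps power2_eq_square power3_eq_cube)
  also have "\<dots> \<le> h^2 / 4 * (1 + r^2) * L' * K'
      + ((2 * r * H' + H) * (K + r * K') + L^2 + (3 * r * L + 2 * r^2 * L') * L') * (\<Phi> * h^3 / 4)
      + (H * K' + L * L') * ((1 + r) * (K + K') * h^3) / 8
      + (H' * K + L' * L) * ((1 + r) * (K + K') * h^3) / 6"
    using 2 3 by linarith
  also have "\<dots> = h^2 / 4 * (1 + r^2) * L' * K'
   + h^3 / 4 * (1 + r) * K' *
       ((2 * r * H' + H) * (K + r * K') + L^2 + (3 * r * L + 2 * r^2 * L') * L') * phi (\<Lambda> * h)
   + h^3 / 24 * (1 + r) * (K + K') * (3 * (H * K' + L * L') + 4 * (H' * K + L * L'))"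
  proof -
    have "A + U * (\<Phi> * h^3 / 4) + Q * ((1 + r) * (K + K') * h^3) / 8 + Q' * ((1 + r) * (K + K') * h^3) / 6
        = A + h^3 / 4 * (1 + r) * K' * U * phi (\<Lambda> * h) + h^3 / 24 * (1 + r) * (K + K') * (3 * Q + 4 * Q')"
      for A U Q Q' :: real
      unfolding \<Phi>_def by (simp add: field_simps)
    from this[of _ _ "H * K' + L * L'" "H' * K + L' * L"] show ?thesis by (simp only: mult.commute[of L' L])
  qed
  finally show ?thesis .
qed

end

section \<open>The local error\<close>

lemma time_partition_bounds:
  assumes "time_partition T N t" "k < N"
  shows "0 \<le> t k" "t k < t (Suc k)" "t (Suc k) \<le> T"
proof -
  have inc: "j < N \<Longrightarrow> t j < t (Suc j)" for j using assms(1) by (simp add: time_partition_def)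
  have mono: "t i \<le> t j" if "i \<le> j" "j \<le> N" for i j
    using that
  proof (induction j rule: dec_induct)
    case (step j)
    then show ?case using inc[of j] by simp
  qed simp
  show "0 \<le> t k" "t k < t (Suc k)" "t (Suc k) \<le> T"
    using mono[of 0 k] mono[of "Suc k" N] inc[of k] assms by (auto simp: time_partition_def)
qed

lemma admissible_input_integrable:
  assumes "admissible_input V a b v"
  shows "v i integrable_on {a..b}"
proof (rule measurable_bounded_by_integrable_imp_integrable_real)
  show "v i \<in> borel_measurable (lebesgue_on {a..b})" using assms by (simp add: admissible_input_def)
  show "(\<lambda>_. V i) integrable_on {a..b}" by (rule integrable_const_ivl)
  show "\<bar>v i s\<bar> \<le> V i" if "s \<in> {a..b}" for s
    using assms that by (auto simp: admissible_input_def abs_le_iff) (smt (verit) atLeastAtMost_iff)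
qed simp

lemma admissible_input_bound:
  assumes "admissible_input V a b v" "s \<in> {a..b}"
  shows "\<bar>v i s\<bar> \<le> V i"
  using assms unfolding admissible_input_def abs_le_iff by (metis atLeastAtMost_iff minus_le_iff)

text \<open>The smallness condition makes the factor \<open>1 - h l\<close> at least \<open>1/2\<close> and gives \<open>h \<le> 1\<close>, so that third powers
  of \<open>h\<close> are at most second powers and \<open>phi (\<Lambda> h)\<close> is at most \<open>exp \<bar>\<Lambda>\<bar>\<close>.\<close>

lemma quadratic_bound_of_small_step:
  fixes h e c l p2 p3 p4 \<Lambda> :: real
  assumes h_pos: "0 < h" and small: "h * (2 * (\<bar>l\<bar> + 1)) \<le> 1" and e: "0 \<le> e"
    and bound: "(1 - h * l) * e \<le> h^2 * p2 + h^3 * p3 * phi (\<Lambda> * h) + h^3 * p4"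
  shows "e \<le> 2 * (\<bar>p2\<bar> + \<bar>p3\<bar> * exp \<bar>\<Lambda>\<bar> + \<bar>p4\<bar>) * h^2"
proof -
  have "h * 2 \<le> h * (2 * (\<bar>l\<bar> + 1))" using h_pos by (intro mult_left_mono) auto
  also note small
  finally have h: "0 < h" "h \<le> 1" using h_pos by auto
  have "h * l \<le> h * (\<bar>l\<bar> + 1)" using h by (intro mult_left_mono) auto
  then have "1 / 2 \<le> 1 - h * l" using small by (simp add: algebra_simps)
  then have "e / 2 \<le> (1 - h * l) * e" using mult_right_mono[OF _ e, of "1/2" "1 - h * l"] by simp
  also note bound
  also have "h^2 * p2 + h^3 * p3 * phi (\<Lambda> * h) + h^3 * p4 \<le> h^2 * \<bar>p2\<bar> + h^2 * (\<bar>p3\<bar> * exp \<bar>\<Lambda>\<bar>) + h^2 * \<bar>p4\<bar>"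
  proof (intro add_mono)
    have h3: "h^3 \<le> h^2" using h power_decreasing[of 2 3 h] by simp
    show "h^2 * p2 \<le> h^2 * \<bar>p2\<bar>" by (intro mult_left_mono) auto
    have "h^3 * p4 \<le> h^3 * \<bar>p4\<bar>" using h by (intro mult_left_mono) auto
    also have "\<dots> \<le> h^2 * \<bar>p4\<bar>" using h3 by (intro mult_right_mono) auto
    finally show "h^3 * p4 \<le> h^2 * \<bar>p4\<bar>" .
    have "phi (\<Lambda> * h) \<le> exp \<bar>\<Lambda> * h\<bar>" by (rule phi_le_exp_abs)
    also have "\<dots> \<le> exp \<bar>\<Lambda>\<bar>" using h by (simp add: abs_mult mult_left_le)
    finally have \<phi>: "phi (\<Lambda> * h) \<le> exp \<bar>\<Lambda>\<bar>" .
    have "h^3 * (p3 * phi (\<Lambda> * h)) \<le> h^3 * (\<bar>p3\<bar> * phi (\<Lambda> * h))"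
      using h phi_pos[of "\<Lambda> * h"] by (intro mult_left_mono mult_right_mono) auto
    also have "\<dots> \<le> h^2 * (\<bar>p3\<bar> * exp \<bar>\<Lambda>\<bar>)"
      using h3 h \<phi> phi_pos[of "\<Lambda> * h"] by (intro mult_mono mult_nonneg_nonneg) auto
    finally show "h^3 * p3 * phi (\<Lambda> * h) \<le> h^2 * (\<bar>p3\<bar> * exp \<bar>\<Lambda>\<bar>)" by (simp add: mult.assoc)
  qed
  finally show ?thesis by (simp add: algebra_simps)
qed

theorem theorem8:
  fixes V Kg Lg Hg :: "'m::finite \<Rightarrow> real" and K \<Lambda> L H r :: real
  assumes V_pos: "\<And>i. V i > 0"
  shows "\<exists>C. \<exists>\<delta>>0. \<forall>(f :: real^'n \<Rightarrow> real^'n) (g :: 'm \<Rightarrow> real^'n \<Rightarrow> real^'n) lo hi T N t k v w x y.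
    let h = t (Suc k) - t k; mid = t k + h / 2; J = {t k..t (Suc k)}; B = cbox lo hi;
        err = infnorm (x (t (Suc k)) - y (t (Suc k)));
        K' = (\<Sum>i\<in>UNIV. V i * Kg i); L' = (\<Sum>i\<in>UNIV. V i * Lg i); H' = (\<Sum>i\<in>UNIV. V i * Hg i)
    in
      time_partition T N t \<and> k < N \<and>
      C2_fun f \<and> (\<forall>i. C2_fun (g i) \<and> \<not> g i constant_on UNIV) \<and>
      field_bounds B f g K Kg \<Lambda> L Lg H Hg \<and>
      admissible_input V 0 T v \<and>
      admissible_input (\<lambda>i. r * V i) (t k) (t (Suc k)) w \<and>
      (\<forall>i. integral J (\<lambda>s. v i s - w i s) = 0) \<and>
      (\<forall>i. integral J (\<lambda>s. (s - mid) * (v i s - w i s)) = 0) \<and>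
      input_affine_solution f g v (t k) (t (Suc k)) x \<and>
      input_affine_solution f g w (t k) (t (Suc k)) y \<and>
      x (t k) = y (t k) \<and> x ` J \<subseteq> B \<and> y ` J \<subseteq> B
    \<longrightarrow>
      (h \<le> \<delta> \<longrightarrow> err \<le> C * h^2) \<and>
      (1 - L * (h / 2) - h * r * L') * err \<le>
          h^2 / 4 * (1 + r^2) * L' * K'
        + h^3 / 4 * (1 + r) * K' *
            ((2 * r * H' + H) * (K + r * K') + L^2 + (3 * r * L + 2 * r^2 * L') * L') * phi (\<Lambda> * h)
        + h^3 / 24 * (1 + r) * (K + K') * (3 * (H * K' + L * L') + 4 * (H' * K + L * L'))"
proof -
  define k' where "k' = (\<Sum>i\<in>UNIV. V i * Kg i)"
  define l' where "l' = (\<Sum>i\<in>UNIV. V i * Lg i)"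
  define h' where "h' = (\<Sum>i\<in>UNIV. V i * Hg i)"
  define p2 where "p2 = 1 / 4 * (1 + r^2) * l' * k'"
  define p3 where "p3 = 1 / 4 * (1 + r) * k' *
    ((2 * r * h' + H) * (K + r * k') + L^2 + (3 * r * L + 2 * r^2 * l') * l')"
  define p4 where "p4 = 1 / 24 * (1 + r) * (K + k') * (3 * (H * k' + L * l') + 4 * (h' * K + L * l'))"
  define C where "C = 2 * (\<bar>p2\<bar> + \<bar>p3\<bar> * exp \<bar>\<Lambda>\<bar> + \<bar>p4\<bar>)"
  define \<delta> where "\<delta> = 1 / (2 * (\<bar>L / 2 + r * l'\<bar> + 1))"
  have "0 < 2 * (\<bar>L / 2 + r * l'\<bar> + 1)" by (intro mult_pos_pos add_nonneg_pos abs_ge_zero) simp_all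
  then have "\<delta> > 0" unfolding \<delta>_def by (rule divide_pos_pos[OF zero_less_one])
  have step: "(h \<le> \<delta> \<longrightarrow> infnorm (x b - y b) \<le> C * h^2) \<and>
      (1 - L * (h / 2) - h * r * l') * infnorm (x b - y b) \<le>
          h^2 / 4 * (1 + r^2) * l' * k'
        + h^3 / 4 * (1 + r) * k' *
            ((2 * r * h' + H) * (K + r * k') + L^2 + (3 * r * L + 2 * r^2 * l') * l') * phi (\<Lambda> * h)
        + h^3 / 24 * (1 + r) * (K + k') * (3 * (H * k' + L * l') + 4 * (h' * K + L * l'))"
    if part: "time_partition T N t" "k < N" and ab: "a = t k" "b = t (Suc k)" and h: "h = b - a"
      and C2: "C2_fun f" "\<forall>i. C2_fun (g i) \<and> \<not> g i constant_on UNIV"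
      and bounds: "field_bounds (cbox lo hi) f g K Kg \<Lambda> L Lg H Hg"
      and adm: "admissible_input V 0 T v" "admissible_input (\<lambda>i. r * V i) a b w"
      and mom: "\<forall>i. integral {a..b} (\<lambda>s. v i s - w i s) = 0"
        "\<forall>i. integral {a..b} (\<lambda>s. (s - (a + h / 2)) * (v i s - w i s)) = 0"
      and sol: "input_affine_solution f g v a b x" "input_affine_solution f g w a b y"
      and xy: "x a = y a" "x ` {a..b} \<subseteq> cbox lo hi" "y ` {a..b} \<subseteq> cbox lo hi"
    for f :: "real^'n \<Rightarrow> real^'n" and g :: "'m \<Rightarrow> real^'n \<Rightarrow> real^'n" and lo hi T N t k v w x y a b h
  proof -
    have tb: "0 \<le> a" "a < b" "b \<le> T" using time_partition_bounds[OF part] ab by auto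
    then have sub: "{a..b} \<subseteq> {0..T}" by auto
    have w: "\<bar>w i s\<bar> \<le> r * V i" if "s \<in> {a..b}" for i s
      using admissible_input_bound[OF adm(2) that] .
    have "0 \<le> r * V i" for i using w[of a i] tb abs_ge_zero[of "w i a"] by auto
    then have r: "0 \<le> r" using V_pos by (metis zero_le_mult_iff not_le)
    have mid: "a + h / 2 = (a + b) / 2" by (simp add: h field_simps)
    interpret coupled_step f g "cbox lo hi" V Kg Lg Hg K \<Lambda> L H a b r v w x y
    proof
      show "cbox lo hi \<noteq> {}" using xy(2) tb by auto
      show "\<bar>v i s\<bar> \<le> V i" if "s \<in> {a..b}" for i s
        using admissible_input_bound[OF adm(1)] that sub by blast
      show "v i integrable_on {a..b}" for i
        by (rule integrable_subinterval_real[OF admissible_input_integrable[OF adm(1)] sub])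
      show "w i integrable_on {a..b}" for i by (rule admissible_input_integrable[OF adm(2)])
    qed (use C2 bounds V_pos tb r w mom[unfolded mid] sol xy in \<open>auto intro: less_imp_le convex_box\<close>)
    have main: "(1 - L * (h / 2) - h * r * l') * infnorm (x b - y b) \<le>
          h^2 / 4 * (1 + r^2) * l' * k'
        + h^3 / 4 * (1 + r) * k' *
            ((2 * r * h' + H) * (K + r * k') + L^2 + (3 * r * L + 2 * r^2 * l') * l') * phi (\<Lambda> * h)
        + h^3 / 24 * (1 + r) * (K + k') * (3 * (H * k' + L * l') + 4 * (h' * K + L * l'))"
      using local_error_le unfolding K'_def L'_def H'_def k'_def l'_def h'_def h .
    have "infnorm (x b - y b) \<le> C * h^2" if small: "h \<le> \<delta>"
      unfolding C_def
    proof (rule quadratic_bound_of_small_step[where l = "L / 2 + r * l'"])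
      show "0 < h" using tb h by simp
      have pos: "0 < 2 * (\<bar>L / 2 + r * l'\<bar> + 1)" by (intro mult_pos_pos add_nonneg_pos abs_ge_zero) simp_all
      show "h * (2 * (\<bar>L / 2 + r * l'\<bar> + 1)) \<le> 1"
        using small pos unfolding \<delta>_def by (simp only: pos_le_divide_eq)
      have "(1 - h * (L / 2 + r * l')) * infnorm (x b - y b) = (1 - L * (h / 2) - h * r * l') * infnorm (x b - y b)"
        by (simp add: algebra_simps)
      also note main
      also have "h^2 / 4 * (1 + r^2) * l' * k'
        + h^3 / 4 * (1 + r) * k' *
            ((2 * r * h' + H) * (K + r * k') + L^2 + (3 * r * L + 2 * r^2 * l') * l') * phi (\<Lambda> * h)
        + h^3 / 24 * (1 + r) * (K + k') * (3 * (H * k' + L * l') + 4 * (h' * K + L * l'))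
        = h^2 * p2 + h^3 * p3 * phi (\<Lambda> * h) + h^3 * p4"
        unfolding p2_def p3_def p4_def by simp
      finally show "(1 - h * (L / 2 + r * l')) * infnorm (x b - y b) \<le> h^2 * p2 + h^3 * p3 * phi (\<Lambda> * h) + h^3 * p4" .
    qed (rule infnorm_pos_le)
    with main show ?thesis by blast
  qed
  show ?thesis
    unfolding Let_def k'_def[symmetric] l'_def[symmetric] h'_def[symmetric]
  proof (intro exI[of _ C] exI[of _ \<delta>] conjI[OF \<open>\<delta> > 0\<close>] allI impI, elim conjE, goal_cases)
    case (1 f g lo hi T N t k v w x y)
    show ?case by (rule step[OF 1(1,2) refl refl refl 1(3-)])
  qed
qed

end
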